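(* Let $\Delta\subset\mathbb{R}^d$ be a bounded set of perturbations, and let $\mathfrak{r}$ be a probability measure fully supported on $\Delta$ and absolutely continuous with respect to the Lebesgue measure. Let $\mathcal{X}\subseteq\mathbb{R}^d$ be nonempty with $x+\delta\in\mathcal{X}$ for all $x\in\mathcal{X}$, $\delta\in\Delta$, let $\mathcal{Y}$ be a finite label set with at least two elements, and let $\ell(\hat y,y)=\mathbb{I}[\hat y\ne y]$ be the 0-1 loss. For every $\rho_o\in(0,1/2)$ there exists a hypothesis class $\mathcal{H}_o$ of functions $h:\mathcal{X}\to\mathcal{Y}$ such that the sample complexity $N$ of probabilistically robust learning at level $\rho$ over $\mathcal{H}_o$, i.e. the number of i.i.d. samples needed for $|P_r^\star-\hat P_r^\star|\le\epsilon$ with high probability, is $$N=\begin{cases}\Theta\big(\log_2(1/\rho_o)/\epsilon^2\big), & \rho=0,\\ \Theta(1/\epsilon^2), & \rho_o\le\rho\le 1-\rho_o.\end{cases}$$ In particular, $\Theta(1/\epsilon^2)$ is the sample complexity, over the same class $\mathcal{H}_o$, of the nominal learning problem $\min_{h\in\mathcal{H}_o}\mathbb{E}_{(x,y)\sim\mathfrak{D}}[\ell(h(x),y)]$.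
   Context: For $\rho\in[0,1)$, a probability measure $\mathfrak{p}$ and a measurable real function $f$, the $\rho$-essential supremum is $\rho\text{-}\operatorname{ess\,sup}_{z\sim\mathfrak{p}} f(z)=\inf\{u\in\mathbb{R}:\mathfrak{p}(\{f>u\})\le\rho\}$ (for $\rho=0$ this is the usual essential supremum). For a distribution $\mathfrak{D}$ on $\mathcal{X}\times\mathcal{Y}$, a hypothesis class $\mathcal{H}$ and a level $\rho$, the optimal value of probabilistically robust learning is $$P_r^\star=\min_{h\in\mathcal{H}}\ \mathbb{E}_{(x,y)\sim\mathfrak{D}}\Big[\rho\text{-}\operatorname{ess\,sup}_{\delta\sim\mathfrak{r}}\ \ell(h(x+\delta),y)\Big],$$ and its empirical version, based on i.i.d. samples $(x_n,y_n)\sim\mathfrak{D}$, $n=1,\dots,N$, is $$\hat P_r^\star=\min_{h\in\mathcal{H}}\ \frac1N\sum_{n=1}^N\Big[\rho\text{-}\operatorname{ess\,sup}_{\delta\sim\mathfrak{r}}\ \ell(h(x_n+\delta),y_n)\Big].$$ The sample complexity is understood in the distribution-free (PAC) sense: it is the number $N$ of samples needed so that, for every distribution $\mathfrak{D}$ on $\mathcal{X}\times\mathcal{Y}$, the optimal value and its empirical version differ by at most $\epsilon$ with probability at least $1-\eta$ over the draw of the samples, where $\eta\in(0,1/4)$ is a fixed confidence parameter. For the nominal problem, the sample complexity is defined in the same way with $\mathbb{E}[\ell(h(x),y)]$ and $\frac1N\sum_n\ell(h(x_n),y_n)$ as the objectives. $\Theta$ means upper and lower bounds up to positive constants that may depend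 on $\eta$ but not on $\rho_o$, $\rho$ or $\epsilon$, for all sufficiently small accuracies $\epsilon>0$. The class $\mathcal{H}_o$ may depend on $\rho_o$ (and on $\Delta,\mathfrak{r}$) but not on $\rho$ or $\epsilon$. *)

theory Defs
  imports "HOL-Probability.Probability"
begin

(* The infimum is taken in the reals, so this is the intended quantity whenever f is bounded,
   p is a probability measure and 0 <= rho < 1. *)
definition rho_esssup :: "real \<Rightarrow> 'z measure \<Rightarrow> ('z \<Rightarrow> real) \<Rightarrow> real" where
  "rho_esssup \<rho> p f = Inf {u. measure p {z \<in> space p. f z > u} \<le> \<rho>}"

definition zero_one_loss :: "'y \<Rightarrow> 'y \<Rightarrow> real" where
  "zero_one_loss y' y = (if y' \<noteq> y then 1 else 0)"

definition robust_loss ::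
  "real \<Rightarrow> 'a measure \<Rightarrow> ('a :: plus \<Rightarrow> 'y) \<Rightarrow> 'a \<times> 'y \<Rightarrow> real" where
  "robust_loss \<rho> r h = (\<lambda>(x, y). rho_esssup \<rho> r (\<lambda>\<delta>. zero_one_loss (h (x + \<delta>)) y))"

definition nominal_loss :: "('a \<Rightarrow> 'y) \<Rightarrow> 'a \<times> 'y \<Rightarrow> real" where
  "nominal_loss h = (\<lambda>(x, y). zero_one_loss (h x) y)"

(* Only the measurable structure of X \<times> Y matters here: Borel sets of the subspace X, all subsets
   of the finite set Y. *)
definition data_space :: "'a :: topological_space set \<Rightarrow> 'y set \<Rightarrow> ('a \<times> 'y) measure" where
  "data_space X Y = restrict_space borel X \<Otimes>\<^sub>M count_space Y"

(* Hypotheses are total functions in HOL; only their values on X are ever used. *)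
definition hypothesis_class :: "'a :: topological_space set \<Rightarrow> 'y set \<Rightarrow> ('a \<Rightarrow> 'y) set \<Rightarrow> bool" where
  "hypothesis_class X Y H \<longleftrightarrow> H \<noteq> {} \<and> H \<subseteq> restrict_space borel X \<rightarrow>\<^sub>M count_space Y"

definition opt_value :: "('h \<Rightarrow> 'z \<Rightarrow> real) \<Rightarrow> 'h set \<Rightarrow> 'z measure \<Rightarrow> real" where
  "opt_value L H D = (INF h\<in>H. \<integral>z. L h z \<partial>D)"

definition emp_opt_value ::
  "('h \<Rightarrow> 'z \<Rightarrow> real) \<Rightarrow> 'h set \<Rightarrow> nat \<Rightarrow> (nat \<Rightarrow> 'z) \<Rightarrow> real" where
  "emp_opt_value L H N s = (INF h\<in>H. (1 / real N) * (\<Sum>n<N. L h (s n)))"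

(* M supplies the sample space and its sigma-algebra, over which all distributions D range. *)
definition samples_suffice ::
  "'z measure \<Rightarrow> ('h \<Rightarrow> 'z \<Rightarrow> real) \<Rightarrow> 'h set \<Rightarrow> real \<Rightarrow> real \<Rightarrow> nat \<Rightarrow> bool" where
  "samples_suffice M L H \<eta> \<epsilon> N \<longleftrightarrow>
     (\<forall>D. prob_space D \<and> sets D = sets M \<longrightarrow>
        measure (\<Pi>\<^sub>M n\<in>{..<N}. D)
          {s \<in> space (\<Pi>\<^sub>M n\<in>{..<N}. D). \<bar>opt_value L H D - emp_opt_value L H N s\<bar> \<le> \<epsilon>}
        \<ge> 1 - \<eta>)"

(* Infinite if no sample size suffices.  The empirical problem makes sense for N > 0 only. *)
definition sample_complexity ::
  "'z measure \<Rightarrow> ('h \<Rightarrow> 'z \<Rightarrow> real) \<Rightarrow> 'h set \<Rightarrow> real \<Rightarrow> real \<Rightarrow> enat" where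
  "sample_complexity M L H \<eta> \<epsilon> = (INF N\<in>{N. 0 < N \<and> samples_suffice M L H \<eta> \<epsilon> N}. enat N)"

definition within_factors :: "real \<Rightarrow> real \<Rightarrow> enat \<Rightarrow> real \<Rightarrow> bool" where
  "within_factors c C N g \<longleftrightarrow>
     ereal (c * g) \<le> ereal_of_enat N \<and> ereal_of_enat N \<le> ereal (C * g)"

(* A measure r on the subspace \<Delta> amounts to a Borel measure on the ambient space that is
   concentrated on \<Delta>; no measurability of \<Delta> itself is needed. *)
definition fully_supported_on :: "'a :: topological_space measure \<Rightarrow> 'a set \<Rightarrow> bool" where
  "fully_supported_on r \<Delta> \<longleftrightarrow>
     sets r = sets (restrict_space borel \<Delta>) \<and>
     (\<forall>U. open U \<and> U \<inter> \<Delta> \<noteq> {} \<longrightarrow> measure r (U \<inter> \<Delta>) > 0)"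

(* Since r lives on the subspace \<Delta>, it is pushed forward along the inclusion of \<Delta> before
   being compared with Lebesgue measure on the ambient space. *)
definition lebesgue_abs_continuous :: "'a :: euclidean_space measure \<Rightarrow> bool" where
  "lebesgue_abs_continuous r \<longleftrightarrow> absolutely_continuous lborel (distr r borel (\<lambda>\<delta>. \<delta>))"

end

theory Submission
  imports Defs
begin

text \<open>Put \<open>m = \<lceil>log\<^sub>2 (1 / \<rho>\<^sub>o)\<rceil>\<close> and choose \<open>2 m\<close> points of \<open>X\<close>, grouped in pairs, so far apart that
  their perturbation sets do not meet. A hypothesis is given by a choice of one point from every
  pair; it takes the value \<open>y\<^sub>1\<close> only on a tiny ball within perturbation range of each chosen point. The
  balls of different hypotheses are disjoint, and by compactness and absence of atoms every
  perturbation set gives them total mass less than \<open>\<rho>\<^sub>o\<close>. At levels in \<open>[\<rho>\<^sub>o, 1 - \<rho>\<^sub>o]\<close> the balls are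
  invisible and all hypotheses have the loss of the constant \<open>y\<^sub>0\<close>; for the nominal loss, disjointness
  makes the total variance of all deviations \<open>O(1 / N)\<close>, so Chebyshev's inequality gives \<open>O(1 / \<epsilon>\<^sup>2)\<close>.
  At level \<open>0\<close> every chosen point labelled \<open>y\<^sub>0\<close> costs \<open>1\<close> and every other one \<open>0\<close>, so the \<open>2 ^ m\<close> losses form a
  cube. The upper bound is Hoeffding's inequality with a union bound. For the lower bound, under
  the uniform distribution on the points every hypothesis has risk \<open>1/2\<close>, while the empirical optimum is
  smaller by \<open>(\<Sum>i. \<bar>S\<^sub>i\<bar>) / (2 N)\<close>, where \<open>S\<^sub>i\<close> is the difference of the two counts in the \<open>i\<close>-th pair;
  moment bounds and the Paley-Zygmund inequality show that this is of order \<open>\<surd>(m / N)\<close> with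
  probability at least \<open>1/4\<close>.\<close>

section \<open>Moments of sums of independent samples\<close>

context
  fixes D :: "'z measure" and g :: "'z \<Rightarrow> real" and B :: real
  assumes D: "prob_space D" and g [measurable]: "g \<in> borel_measurable D"
    and bd: "\<And>z. z \<in> space D \<Longrightarrow> \<bar>g z\<bar> \<le> B"
begin

lemma integrable_bounded_power: "integrable D (\<lambda>z. g z ^ p)"
proof -
  interpret prob_space D by (rule D)
  show ?thesis
    by (rule integrable_const_bound[where B = "B ^ p"]) (auto simp: power_abs intro!: power_mono bd)
qed

lemma integrable_sample_sum_power:
  fixes N :: nat
  shows "integrable (\<Pi>\<^sub>M n\<in>{..<N}. D) (\<lambda>s. (\<Sum>n<N. g (s n)) ^ p)"
proof -
  interpret prob_space "\<Pi>\<^sub>M n\<in>{..<N}. D" by (intro prob_space_PiM D)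
  have "\<bar>\<Sum>n<N. g (s n)\<bar> \<le> real N * B" if "s \<in> space (\<Pi>\<^sub>M n\<in>{..<N}. D)" for s
  proof -
    have "\<bar>\<Sum>n<N. g (s n)\<bar> \<le> (\<Sum>n<N. \<bar>g (s n)\<bar>)" by (rule sum_abs)
    also have "\<dots> \<le> (\<Sum>n<N. B)"
      using that by (intro sum_mono bd) (auto simp: space_PiM PiE_iff)
    finally show ?thesis by simp
  qed
  then show ?thesis
    by (intro integrable_const_bound[where B = "(real N * B) ^ p"])
       (auto simp: power_abs intro!: power_mono)
qed

text \<open>Fubini: the last sample is split off and integrated first, which makes the moments of
  sample sums accessible to induction on \<open>N\<close>.\<close>

lemma integral_sample_sum_power_Suc:
  "(\<integral>s. (\<Sum>n<Suc N. g (s n)) ^ p \<partial>(\<Pi>\<^sub>M n\<in>{..<Suc N}. D)) =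
   (\<integral>s. (\<integral>z. ((\<Sum>n<N. g (s n)) + g z) ^ p \<partial>D) \<partial>(\<Pi>\<^sub>M n\<in>{..<N}. D))"
proof -
  interpret prob_space D by (rule D)
  interpret product_sigma_finite "\<lambda>_. D" by unfold_locales
  have "(\<integral>s. (\<Sum>n<Suc N. g (s n)) ^ p \<partial>(\<Pi>\<^sub>M n\<in>insert N {..<N}. D)) =
    (\<integral>s. (\<integral>z. (\<Sum>n<Suc N. g ((s(N := z)) n)) ^ p \<partial>D) \<partial>(\<Pi>\<^sub>M n\<in>{..<N}. D))"
    using integrable_sample_sum_power[of "Suc N" p]
    by (intro product_integral_insert) (auto simp: lessThan_Suc)
  then show ?thesis by (simp add: lessThan_Suc add.commute)
qed

context
  assumes g0: "(\<integral>z. g z \<partial>D) = 0"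
begin

text \<open>Integrating the new sample first kills the cross term because \<open>g\<close> is
  centered, so every sample adds its own second moment.\<close>

lemma integral_sample_sum_square_centered:
  "(\<integral>s. (\<Sum>n<N. g (s n))\<^sup>2 \<partial>(\<Pi>\<^sub>M n\<in>{..<N}. D)) = real N * (\<integral>z. (g z)\<^sup>2 \<partial>D)"
proof (induction N)
  case (Suc N)
  interpret prob_space D by (rule D)
  interpret P: prob_space "\<Pi>\<^sub>M n\<in>{..<N}. D" by (intro prob_space_PiM D)
  have [simp]: "integrable D g" "integrable D (\<lambda>z. (g z)\<^sup>2)"
    using integrable_bounded_power[of 1] integrable_bounded_power[of 2] by auto
  have "(\<integral>z. ((\<Sum>n<N. g (s n)) + g z)\<^sup>2 \<partial>D) = (\<Sum>n<N. g (s n))\<^sup>2 + (\<integral>z. (g z)\<^sup>2 \<partial>D)" for s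
    by (simp add: power2_sum g0 prob_space)
  then show ?case
    using Suc integral_sample_sum_power_Suc[of N 2] integrable_sample_sum_power[of N 2]
    by (simp add: P.prob_space algebra_simps)
qed simp

text \<open>With vanishing first and third moments only the even terms of the binomial expansion
  survive. The mixed term contributes \<open>6 * n\<close> squared variances at step
  \<open>n\<close>, which add up to \<open>3 * N * (N - 1)\<close>.\<close>

lemma integral_sample_sum_fourth_centered:
  assumes g3: "(\<integral>z. g z ^ 3 \<partial>D) = 0"
  shows "(\<integral>s. (\<Sum>n<N. g (s n)) ^ 4 \<partial>(\<Pi>\<^sub>M n\<in>{..<N}. D)) =
    real N * (\<integral>z. g z ^ 4 \<partial>D) + 3 * real N * (real N - 1) * (\<integral>z. (g z)\<^sup>2 \<partial>D)\<^sup>2"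
proof (induction N)
  case (Suc N)
  interpret prob_space D by (rule D)
  interpret P: prob_space "\<Pi>\<^sub>M n\<in>{..<N}. D" by (intro prob_space_PiM D)
  have [simp]: "integrable D g" "integrable D (\<lambda>z. (g z)\<^sup>2)" "integrable D (\<lambda>z. g z ^ 3)"
     "integrable D (\<lambda>z. g z ^ 4)"
    using integrable_bounded_power[of 1] integrable_bounded_power[of 2] 
      integrable_bounded_power[of 3] integrable_bounded_power[of 4] by auto
  have eq: "(a + b) ^ 4 = a ^ 4 + 4 * a ^ 3 * b + 6 * a\<^sup>2 * b\<^sup>2 + 4 * a * b ^ 3 + b ^ 4" for a b :: real
    by (simp add: power_def algebra_simps power2_eq_square eval_nat_numeral)
  have "(\<integral>z. ((\<Sum>n<N. g (s n)) + g z) ^ 4 \<partial>D) = 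
     (\<Sum>n<N. g (s n)) ^ 4 + 6 * (\<Sum>n<N. g (s n))\<^sup>2 * (\<integral>z. (g z)\<^sup>2 \<partial>D) + (\<integral>z. g z ^ 4 \<partial>D)" for s
    by (simp add: eq g0 g3 prob_space)
  then have "(\<integral>s. (\<Sum>n<Suc N. g (s n)) ^ 4 \<partial>(\<Pi>\<^sub>M n\<in>{..<Suc N}. D)) =
     (\<integral>s. (\<Sum>n<N. g (s n)) ^ 4 \<partial>(\<Pi>\<^sub>M n\<in>{..<N}. D)) +
     6 * (\<integral>s. (\<Sum>n<N. g (s n))\<^sup>2 \<partial>(\<Pi>\<^sub>M n\<in>{..<N}. D)) * (\<integral>z. (g z)\<^sup>2 \<partial>D) + (\<integral>z. g z ^ 4 \<partial>D)"
    using integral_sample_sum_power_Suc[of N 4] integrable_sample_sum_power[of N 2]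
      integrable_sample_sum_power[of N 4]
    by (simp add: P.prob_space del: sum.lessThan_Suc)
  also have "\<dots> = real (Suc N) * (\<integral>z. g z ^ 4 \<partial>D) +
      3 * real (Suc N) * (real (Suc N) - 1) * (\<integral>z. (g z)\<^sup>2 \<partial>D)\<^sup>2"
    unfolding Suc integral_sample_sum_square_centered by (simp add: power2_eq_square algebra_simps)
  finally show ?case .
qed simp

end

end

text \<open>The usual Cauchy-Schwarz argument is replaced by integrating a pointwise quadratic bound
  for \<open>Z\<close>. Only a lower bound \<open>\<mu>\<close> on the mean and an upper bound
  \<open>B\<close> on the second moment are known in the applications, hence this form.\<close>

lemma paley_zygmund:
  fixes Z :: "'z \<Rightarrow> real"
  assumes M: "prob_space M" and Z [measurable]: "integrable M Z" and Z2: "integrable M (\<lambda>x. (Z x)\<^sup>2)"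
    and \<mu>: "\<mu> \<le> (\<integral>x. Z x \<partial>M)" and B: "(\<integral>x. (Z x)\<^sup>2 \<partial>M) \<le> B" "0 < B" and t: "0 \<le> t" "t < \<mu>"
  shows "measure M {x \<in> space M. Z x > t} \<ge> (\<mu> - t)\<^sup>2 / B"
proof -
  interpret prob_space M by (rule M)
  \<comment> \<open>This choice makes the quadratic term cost exactly half of the gap
    \<open>\<mu> - t\<close>.\<close>
  define \<alpha> where "\<alpha> = (\<mu> - t) / B"
  have \<alpha>: "\<alpha> > 0" using t B by (simp add: \<alpha>_def)
  let ?E = "{x \<in> space M. Z x > t}"
  have [measurable]: "Z \<in> borel_measurable M" using Z by simp
  have [simp]: "integrable M (indicator ?E :: _ \<Rightarrow> real)"
    by (rule integrable_const_bound[where B=1]) (auto simp: indicator_def)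
  \<comment> \<open>On the event this is the inequality of arithmetic and geometric means; off the
    event already \<open>Z x \<le> t\<close>.\<close>
  have pw: "Z x \<le> t + \<alpha> / 2 * (Z x)\<^sup>2 + 1 / (2 * \<alpha>) * indicator ?E x" if "x \<in> space M" for x
  proof (cases "Z x > t")
    case True
    have "0 \<le> (\<alpha> * Z x - 1)\<^sup>2 / (2 * \<alpha>)" using \<alpha> by simp
    also have "\<dots> = \<alpha> / 2 * (Z x)\<^sup>2 + 1 / (2 * \<alpha>) - Z x"
      using \<alpha> by (simp add: field_simps power2_eq_square)
    finally show ?thesis using True that t by simp
  next
    case False
    then show ?thesis using \<alpha> by (simp add: add_increasing2)
  qed
  have "\<mu> \<le> (\<integral>x. t + \<alpha> / 2 * (Z x)\<^sup>2 + 1 / (2 * \<alpha>) * indicator ?E x \<partial>M)"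
    by (rule order.trans[OF \<mu>]) (intro integral_mono Z pw; use Z2 in simp)
  also have "\<dots> = t + \<alpha> / 2 * (\<integral>x. (Z x)\<^sup>2 \<partial>M) + 1 / (2 * \<alpha>) * measure M ?E"
    using Z2 by (simp add: prob_space Int_absorb2 Collect_subset)
  also have "\<dots> \<le> t + \<alpha> / 2 * B + 1 / (2 * \<alpha>) * measure M ?E"
    using B \<alpha> by (simp add: mult_left_mono)
  also have "\<alpha> / 2 * B = (\<mu> - t) / 2" using B by (simp add: \<alpha>_def)
  finally have "(\<mu> - t) / 2 \<le> 1 / (2 * \<alpha>) * measure M ?E" by (simp add: field_simps)
  then have "\<alpha> * (\<mu> - t) \<le> measure M ?E" using \<alpha> by (simp add: field_simps)
  then show ?thesis by (simp add: \<alpha>_def power2_eq_square)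
qed

section \<open>Anti-concentration of sums of signs\<close>

context
  fixes D :: "'z measure" and \<xi> :: "'z \<Rightarrow> real"
  assumes D: "prob_space D" and \<xi> [measurable]: "\<xi> \<in> borel_measurable D"
    and signs: "\<And>z. z \<in> space D \<Longrightarrow> \<xi> z \<in> {-1, 0, 1}"
    and \<xi>0: "(\<integral>z. \<xi> z \<partial>D) = 0"
begin

lemma sign_bounded: "z \<in> space D \<Longrightarrow> \<bar>\<xi> z\<bar> \<le> 1"
  using signs[of z] by auto

text \<open>For values in \<open>{-1, 0, 1}\<close> cubes are the values themselves and fourth
  powers are squares, so the third moment vanishes and the fourth equals the second.\<close>

lemma integral_sign_sum_fourth:
  fixes N :: nat
  shows "(\<integral>s. (\<Sum>n<N. \<xi> (s n)) ^ 4 \<partial>(\<Pi>\<^sub>M n\<in>{..<N}. D)) =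
    real N * (\<integral>z. (\<xi> z)\<^sup>2 \<partial>D) + 3 * real N * (real N - 1) * (\<integral>z. (\<xi> z)\<^sup>2 \<partial>D)\<^sup>2"
proof -
  have "(\<integral>z. \<xi> z ^ 3 \<partial>D) = (\<integral>z. \<xi> z \<partial>D)"
    by (intro Bochner_Integration.integral_cong) (use signs in force)+
  moreover have "(\<integral>z. \<xi> z ^ 4 \<partial>D) = (\<integral>z. (\<xi> z)\<^sup>2 \<partial>D)"
    by (intro Bochner_Integration.integral_cong) (use signs in force)+
  ultimately show ?thesis
    using integral_sample_sum_fourth_centered[OF D \<xi> sign_bounded \<xi>0] \<xi>0 by simp
qed

text \<open>Paley-Zygmund for the square of the sum, whose mean is \<open>N\<close> and whose second
  moment is at most \<open>3 * N\<^sup>2\<close>. The threshold \<open>N / 10\<close> leaves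
  \<open>(9/10)\<^sup>2 / 3 = 27/100\<close>, just above \<open>1/4\<close>.\<close>

lemma sign_sum_anti_concentration:
  fixes N :: nat
  assumes one: "(\<integral>z. (\<xi> z)\<^sup>2 \<partial>D) = 1" and N: "0 < N"
  shows "measure (\<Pi>\<^sub>M n\<in>{..<N}. D)
    {s \<in> space (\<Pi>\<^sub>M n\<in>{..<N}. D). (\<Sum>n<N. \<xi> (s n))\<^sup>2 > real N / 10} \<ge> 1/4"
proof -
  let ?S = "\<lambda>s. (\<Sum>n<N. \<xi> (s n))"
  have "(real N - real N / 10)\<^sup>2 / (3 * (real N)\<^sup>2) \<le> measure (\<Pi>\<^sub>M n\<in>{..<N}. D)
    {s \<in> space (\<Pi>\<^sub>M n\<in>{..<N}. D). (?S s)\<^sup>2 > real N / 10}"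
  proof (rule paley_zygmund)
    show "prob_space (\<Pi>\<^sub>M n\<in>{..<N}. D)" by (intro prob_space_PiM D)
    show "integrable (\<Pi>\<^sub>M n\<in>{..<N}. D) (\<lambda>s. (?S s)\<^sup>2)"
      by (rule integrable_sample_sum_power[OF D \<xi> sign_bounded])
    show "integrable (\<Pi>\<^sub>M n\<in>{..<N}. D) (\<lambda>s. ((?S s)\<^sup>2)\<^sup>2)"
      using integrable_sample_sum_power[OF D \<xi> sign_bounded, of N 4] by simp
    show "real N \<le> (\<integral>s. (?S s)\<^sup>2 \<partial>(\<Pi>\<^sub>M n\<in>{..<N}. D))"
      using integral_sample_sum_square_centered[OF D \<xi> sign_bounded \<xi>0] one by simp
    show "(\<integral>s. ((?S s)\<^sup>2)\<^sup>2 \<partial>(\<Pi>\<^sub>M n\<in>{..<N}. D)) \<le> 3 * (real N)\<^sup>2"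
    proof -
      have "((?S s)\<^sup>2)\<^sup>2 = ?S s ^ 4" for s by simp
      moreover have "(\<integral>s. ?S s ^ 4 \<partial>(\<Pi>\<^sub>M n\<in>{..<N}. D)) = real N + 3 * real N * (real N - 1)"
        using integral_sign_sum_fourth[of N] one by simp
      ultimately show ?thesis by (simp add: algebra_simps power2_eq_square[of "real N"])
    qed
  qed (use N in auto)
  moreover have "(real N - real N / 10)\<^sup>2 / (3 * (real N)\<^sup>2) = 27/100"
    using N by (simp add: field_simps power2_eq_square)
  ultimately show ?thesis by linarith
qed

text \<open>The pointwise bound \<open>\<bar>u\<bar> \<ge> 3 u\<^sup>2 / 2 - u ^ 4 / 2\<close>, rescaled by \<open>w\<close>, turns moment bounds into a
  lower bound for the first absolute moment.\<close>

lemma sign_sum_abs_expectation: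
  fixes N :: nat
  defines "v \<equiv> real N * (\<integral>z. (\<xi> z)\<^sup>2 \<partial>D)"
  assumes v: "10 \<le> v" and w: "w = sqrt (31/10 * v)"
  shows "v / w \<le> (\<integral>s. \<bar>\<Sum>n<N. \<xi> (s n)\<bar> \<partial>(\<Pi>\<^sub>M n\<in>{..<N}. D))"
proof -
  let ?S = "\<lambda>s. (\<Sum>n<N. \<xi> (s n))"
  let ?P = "\<Pi>\<^sub>M n\<in>{..<N}. D"
  have w0: "0 < w" and w2: "w\<^sup>2 = 31/10 * v" using v w by auto
  note int = integrable_sample_sum_power[OF D \<xi> sign_bounded, of N]
  have pw: "3 / (2 * w) * y\<^sup>2 - 1 / (2 * w ^ 3) * y ^ 4 \<le> \<bar>y\<bar>" for y :: real
  proof -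
    define u where "u = \<bar>y\<bar> / w"
    have u: "0 \<le> u" "\<bar>y\<bar> = u * w" using w0 by (auto simp: u_def)
    then have y: "y\<^sup>2 = (u * w)\<^sup>2" "y ^ 4 = (u * w) ^ 4"
      by (metis power2_abs, metis power_even_abs_numeral even_numeral)
    \<comment> \<open>The cubic \<open>u ^ 3 - 3 * u + 2\<close> has a double root at
      \<open>1\<close>, so the bound is tight at \<open>\<bar>y\<bar> = w\<close>.\<close>
    have "0 \<le> w * u * ((u - 1)\<^sup>2 * (u + 2))" using u w0 by simp
    also have "\<dots> = 2 * (u * w) - 3 * u\<^sup>2 * w + u ^ 4 * w"
      by (simp add: power2_eq_square eval_nat_numeral algebra_simps)
    finally have "3 * u\<^sup>2 * w / 2 - u ^ 4 * w / 2 \<le> u * w" by simp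
    moreover have "3 / (2 * w) * y\<^sup>2 = 3 * u\<^sup>2 * w / 2"
      unfolding y using w0 by (simp add: power2_eq_square field_simps)
    moreover have "1 / (2 * w ^ 3) * y ^ 4 = u ^ 4 * w / 2"
      unfolding y using w0 by (simp add: eval_nat_numeral field_simps)
    ultimately show ?thesis using u by simp
  qed
  have S2: "(\<integral>s. (?S s)\<^sup>2 \<partial>?P) = v"
    using integral_sample_sum_square_centered[OF D \<xi> sign_bounded \<xi>0] by (simp add: v_def)
  have "(\<integral>s. ?S s ^ 4 \<partial>?P) \<le> v + 3 * v\<^sup>2"
    unfolding integral_sign_sum_fourth v_def by (simp add: power2_eq_square algebra_simps)
  \<comment> \<open>Here \<open>10 \<le> v\<close> absorbs the linear term into a tenth of the
    square; this is the origin of \<open>31/10\<close>.\<close>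
  also have "\<dots> \<le> 31/10 * v\<^sup>2" using v by (simp add: power2_eq_square)
  finally have S4: "(\<integral>s. ?S s ^ 4 \<partial>?P) \<le> 31/10 * v\<^sup>2" .
  \<comment> \<open>The scale \<open>w\<close> is chosen so that the fourth-moment term is exactly
    one third of the second-moment term.\<close>
  have "v / w = 3 / (2 * w) * v - 1 / (2 * w ^ 3) * (31/10 * v\<^sup>2)"
  proof -
    have "1 / (2 * w ^ 3) * (31/10 * v\<^sup>2) = (31/10 * v) * v / (2 * w * w\<^sup>2)"
      by (simp add: power2_eq_square eval_nat_numeral)
    also have "\<dots> = v / (2 * w)" using v by (simp add: w2)
    finally show ?thesis by (simp add: field_simps)
  qed
  also have "\<dots> \<le> 3 / (2 * w) * v - 1 / (2 * w ^ 3) * (\<integral>s. ?S s ^ 4 \<partial>?P)"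
    using S4 w0 by (intro diff_mono mult_left_mono) auto
  also have "\<dots> = (\<integral>s. 3 / (2 * w) * (?S s)\<^sup>2 - 1 / (2 * w ^ 3) * ?S s ^ 4 \<partial>?P)"
    using int[of 2] int[of 4] by (simp add: S2)
  also have "\<dots> \<le> (\<integral>s. \<bar>?S s\<bar> \<partial>?P)"
    using int[of 1] int[of 2] int[of 4] by (intro integral_mono pw) auto
  finally show ?thesis .
qed

end

text \<open>Paley-Zygmund for the sum \<open>W\<close> of the absolute values. Its mean is bounded
  below group by group; its second moment is bounded by Cauchy-Schwarz, which avoids any discussion
  of the dependence between groups.\<close>

lemma sum_abs_sign_sums_anti_concentration:
  fixes N k :: nat and \<xi> :: "nat \<Rightarrow> 'z \<Rightarrow> real"
  assumes D: "prob_space D" and \<xi> [measurable]: "\<And>i. i < k \<Longrightarrow> \<xi> i \<in> borel_measurable D"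
    and signs: "\<And>i z. i < k \<Longrightarrow> z \<in> space D \<Longrightarrow> \<xi> i z \<in> {-1, 0, 1}"
    and \<xi>0: "\<And>i. i < k \<Longrightarrow> (\<integral>z. \<xi> i z \<partial>D) = 0"
    and \<xi>2: "\<And>i. i < k \<Longrightarrow> (\<integral>z. (\<xi> i z)\<^sup>2 \<partial>D) = 1 / real k"
    and k: "0 < k" "10 * k \<le> N"
  shows "measure (\<Pi>\<^sub>M n\<in>{..<N}. D) {s \<in> space (\<Pi>\<^sub>M n\<in>{..<N}. D).
      (\<Sum>i<k. \<bar>\<Sum>n<N. \<xi> i (s n)\<bar>) > real N / (10 * sqrt (31/10 * (real N / real k)))} \<ge> 1/4"
proof -
  let ?P = "\<Pi>\<^sub>M n\<in>{..<N}. D"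
  let ?S = "\<lambda>i s. (\<Sum>n<N. \<xi> i (s n))"
  let ?W = "\<lambda>s. (\<Sum>i<k. \<bar>?S i s\<bar>)"
  define v where "v = real N / real k"
  define w where "w = sqrt (31/10 * v)"
  have v: "10 \<le> v" using k by (simp add: v_def field_simps flip: of_nat_mult)
  then have w0: "0 < w" and w2: "w\<^sup>2 = 31/10 * v" by (auto simp: w_def)
  have N: "0 < real N" "real N = real k * v" using k by (auto simp: v_def)
  interpret P: prob_space ?P by (intro prob_space_PiM D)
  note int = integrable_sample_sum_power[OF D \<xi> sign_bounded[OF D \<xi> signs \<xi>0], where N = N]
  have int1: "integrable ?P (\<lambda>s. \<bar>?S i s\<bar>)" if "i < k" for i
    using int[where p = 1] that by simp
  have int2: "integrable ?P (\<lambda>s. (?S i s)\<^sup>2)" if "i < k" for i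
    using int[where p = 2] that by simp
  have W_le: "(?W s)\<^sup>2 \<le> real k * (\<Sum>i<k. (?S i s)\<^sup>2)" for s
    using Cauchy_Schwarz_ineq_sum[of "\<lambda>_. 1" "\<lambda>i. \<bar>?S i s\<bar>" "{..<k}"] by simp
  have meas [measurable]: "?W \<in> borel_measurable ?P"
    by (intro borel_measurable_integrable Bochner_Integration.integrable_sum int1) auto
  have intW2: "integrable ?P (\<lambda>s. (?W s)\<^sup>2)"
  proof (rule Bochner_Integration.integrable_bound)
    show "integrable ?P (\<lambda>s. real k * (\<Sum>i<k. (?S i s)\<^sup>2))"
      by (intro integrable_mult_right Bochner_Integration.integrable_sum int2) auto
    show "AE s in ?P. norm ((?W s)\<^sup>2) \<le> norm (real k * (\<Sum>i<k. (?S i s)\<^sup>2))"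
      using W_le by (auto simp: sum_nonneg)
  qed measurable
  have "(real N / w - real N / (10 * w))\<^sup>2 / (real k * real N) \<le> 
    measure ?P {s \<in> space ?P. ?W s > real N / (10 * w)}"
  proof (rule paley_zygmund)
    show "prob_space ?P" by (rule P.prob_space_axioms)
    show "integrable ?P ?W" by (intro Bochner_Integration.integrable_sum int1) auto
    show "integrable ?P (\<lambda>s. (?W s)\<^sup>2)" by (rule intW2)
    have "real N / w = (\<Sum>i<k. v / w)" using N by simp
    also have "\<dots> \<le> (\<Sum>i<k. (\<integral>s. \<bar>?S i s\<bar> \<partial>?P))"
    proof (rule sum_mono)
      fix i assume "i \<in> {..<k}"
      then have i: "i < k" by simp
      show "v / w \<le> (\<integral>s. \<bar>?S i s\<bar> \<partial>?P)"
        using sign_sum_abs_expectation[OF D \<xi>[OF i] signs[OF i] \<xi>0[OF i], of N w] v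
        by (simp add: \<xi>2[OF i] w_def v_def)
    qed
    also have "\<dots> = (\<integral>s. ?W s \<partial>?P)"
      by (rule Bochner_Integration.integral_sum[symmetric]) (use int1 in auto)
    finally show "real N / w \<le> (\<integral>s. ?W s \<partial>?P)" .
    have "(\<integral>s. (?W s)\<^sup>2 \<partial>?P) \<le> (\<integral>s. real k * (\<Sum>i<k. (?S i s)\<^sup>2) \<partial>?P)"
      by (intro integral_mono intW2 W_le) (intro integrable_mult_right Bochner_Integration.integrable_sum int2; simp)
    also have "\<dots> = real k * (\<Sum>i<k. (\<integral>s. (?S i s)\<^sup>2 \<partial>?P))"
      using int2 by simp
    also have "(\<Sum>i<k. (\<integral>s. (?S i s)\<^sup>2 \<partial>?P)) = (\<Sum>i<k. real N * (1 / real k))"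
    proof (rule sum.cong)
      fix i assume "i \<in> {..<k}"
      then have i: "i < k" by simp
      show "(\<integral>s. (?S i s)\<^sup>2 \<partial>?P) = real N * (1 / real k)"
        using integral_sample_sum_square_centered[OF D \<xi>[OF i] 
            sign_bounded[OF D \<xi>[OF i] signs[OF i] \<xi>0[OF i]] \<xi>0[OF i], of N]
        by (simp add: \<xi>2[OF i])
    qed simp
    finally show "(\<integral>s. (?W s)\<^sup>2 \<partial>?P) \<le> real k * real N" using k by simp
  next
    show "0 < real k * real N" using N k by simp
    show "real N / (10 * w) < real N / w" using N w0 by (simp add: field_simps)
  qed (use N w0 in simp)
  \<comment> \<open>Keeping nine tenths of the mean gives
    \<open>(81/100) / (31/10) = 81/310\<close>, which still exceeds \<open>1/4\<close>.\<close>
  moreover have "(real N / w - real N / (10 * w))\<^sup>2 / (real k * real N) = 81 / 310"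
  proof -
    have "real N / w - real N / (10 * w) = 9/10 * (real N / w)" by (simp add: field_simps)
    then have "(real N / w - real N / (10 * w))\<^sup>2 = 81/100 * ((real N)\<^sup>2 / w\<^sup>2)"
      by (simp add: power_divide power2_eq_square)
    also have "\<dots> = 81/310 * (real k * real N)"
      unfolding w2 N(2) using v k by (simp add: power2_eq_square field_simps)
    finally show ?thesis using k N v by simp
  qed
  ultimately show ?thesis by (simp add: w_def v_def)
qed

section \<open>Sufficient and insufficient sample sizes\<close>

abbreviation iid :: "nat \<Rightarrow> 'z measure \<Rightarrow> (nat \<Rightarrow> 'z) measure" where
  "iid N D \<equiv> \<Pi>\<^sub>M n\<in>{..<N}. D"

text \<open>A bad event of mass at least \<open>1/4\<close> contradicts a confidence above
  \<open>3/4\<close>. The deviation is asked for only almost surely, because the losses are known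
  only almost everywhere under the hard distributions.\<close>

lemma not_samples_suffice:
  assumes D: "prob_space D" "sets D = sets M" and bad: "bad \<in> sets (iid N D)"
    "measure (iid N D) bad \<ge> 1/4" and \<eta>: "\<eta> < 1/4"
    and dev: "AE s in iid N D. s \<in> bad \<longrightarrow> \<bar>opt_value L H D - emp_opt_value L H N s\<bar> > \<epsilon>"
  shows "\<not> samples_suffice M L H \<eta> \<epsilon> N"
proof
  interpret P: prob_space "iid N D" by (intro prob_space_PiM D)
  let ?G = "{s \<in> space (iid N D). \<bar>opt_value L H D - emp_opt_value L H N s\<bar> \<le> \<epsilon>}"
  assume "samples_suffice M L H \<eta> \<epsilon> N"
  then have G: "1 - \<eta> \<le> P.prob ?G" using D by (simp add: samples_suffice_def)
  have "P.prob ?G \<le> P.prob (space (iid N D) - bad)"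
    by (rule P.finite_measure_mono_AE) (use dev bad in auto)
  also have "\<dots> = 1 - P.prob bad" using bad by (simp add: P.prob_compl)
  finally show False using G bad \<eta> by simp
qed

text \<open>Taking an infimum is 1-Lipschitz for the uniform distance, so uniform convergence over
  the class controls the optimal values. The one-sided estimate is applied twice, with the roles
  exchanged.\<close>

lemma abs_INF_diff_le:
  fixes a b :: "'h \<Rightarrow> real"
  assumes H: "finite H" "H \<noteq> {}" and le: "\<And>h. h \<in> H \<Longrightarrow> \<bar>a h - b h\<bar> \<le> \<epsilon>"
  shows "\<bar>(INF h\<in>H. a h) - (INF h\<in>H. b h)\<bar> \<le> \<epsilon>"
proof -
  have "(INF h\<in>H. f h) - \<epsilon> \<le> (INF h\<in>H. g h)"
    if "\<And>h. h \<in> H \<Longrightarrow> \<bar>f h - g h\<bar> \<le> \<epsilon>" for f g :: "'h \<Rightarrow> real"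
  proof (rule cINF_greatest[OF H(2)])
    fix h assume h: "h \<in> H"
    have "(INF h\<in>H. f h) \<le> f h" by (rule cINF_lower) (use H h in auto)
    then show "(INF h\<in>H. f h) - \<epsilon> \<le> g h" using that[OF h] by simp
  qed
  from this[of a b] this[of b a] le show ?thesis
    by (simp add: abs_le_iff)
qed

section \<open>Upper bounds from uniform convergence over a finite class\<close>

context
  fixes M :: "'z measure" and L :: "'h \<Rightarrow> 'z \<Rightarrow> real" and H :: "'h set"
  assumes H: "finite H" "H \<noteq> {}" and L: "\<And>h. h \<in> H \<Longrightarrow> L h \<in> borel_measurable M"
begin

text \<open>For a finite class the infimum is a minimum of finitely many measurable
  averages.\<close>

lemma borel_measurable_emp_opt_value:
  assumes "sets D = sets M"
  shows "emp_opt_value L H N \<in> borel_measurable (iid N D)"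
proof -
  have [measurable]: "L h \<in> borel_measurable D" if "h \<in> H" for h
    using L[OF that] measurable_cong_sets[OF assms refl] by auto
  have "emp_opt_value L H N = (\<lambda>s. Min ((\<lambda>h. (1 / real N) * (\<Sum>n<N. L h (s n))) ` H))"
    using H by (auto simp: emp_opt_value_def fun_eq_iff cInf_eq_Min)
  moreover have "\<dots> \<in> borel_measurable (iid N D)"
    by (intro borel_measurable_Min H) measurable
  ultimately show ?thesis by simp
qed

text \<open>Reduces both upper bounds to finding a small event outside which all empirical risks are
  close to the true ones.\<close>

lemma samples_sufficeI:
  assumes bad: "\<And>D. prob_space D \<Longrightarrow> sets D = sets M \<Longrightarrow>
     \<exists>bad \<in> sets (iid N D). measure (iid N D) bad \<le> \<eta> \<and>
       (\<forall>s \<in> space (iid N D) - bad. \<forall>h\<in>H. \<bar>(\<integral>z. L h z \<partial>D) - (1 / real N) * (\<Sum>n<N. L h (s n))\<bar> \<le> \<epsilon>)"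
  shows "samples_suffice M L H \<eta> \<epsilon> N"
  unfolding samples_suffice_def
proof (intro allI impI)
  fix D assume D: "prob_space D \<and> sets D = sets M"
  interpret P: prob_space "iid N D" by (intro prob_space_PiM) (use D in auto)
  have [measurable]: "emp_opt_value L H N \<in> borel_measurable (iid N D)"
    by (rule borel_measurable_emp_opt_value) (use D in auto)
  from bad D obtain bad where b: "bad \<in> sets (iid N D)" "measure (iid N D) bad \<le> \<eta>"
    "\<And>s h. s \<in> space (iid N D) - bad \<Longrightarrow> h \<in> H \<Longrightarrow> \<bar>(\<integral>z. L h z \<partial>D) - (1 / real N) * (\<Sum>n<N. L h (s n))\<bar> \<le> \<epsilon>"
    by metis
  have "1 - \<eta> \<le> P.prob (space (iid N D) - bad)" using b by (simp add: P.prob_compl)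
  also have "\<dots> \<le> P.prob {s \<in> space (iid N D). \<bar>opt_value L H D - emp_opt_value L H N s\<bar> \<le> \<epsilon>}"
  proof (rule P.finite_measure_mono)
    show "space (iid N D) - bad \<subseteq>
        {s \<in> space (iid N D). \<bar>opt_value L H D - emp_opt_value L H N s\<bar> \<le> \<epsilon>}"
      using b(3) unfolding opt_value_def emp_opt_value_def by (auto intro!: abs_INF_diff_le H)
  qed measurable
  finally show "1 - \<eta> \<le> P.prob {s \<in> space (iid N D). \<bar>opt_value L H D - emp_opt_value L H N s\<bar> \<le> \<epsilon>}" .
qed

text \<open>Only second moments enter: the deviations of the functions \<open>L h - g\<close> have total variance at
  most \<open>1 / N\<close>, whatever the number of hypotheses.\<close>

lemma samples_suffice_chebyshev:
  fixes g :: "'z \<Rightarrow> real"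
  assumes g: "g \<in> borel_measurable M" and g1: "\<And>z. z \<in> space M \<Longrightarrow> \<bar>g z\<bar> \<le> 1"
    and sq: "\<And>z. z \<in> space M \<Longrightarrow> (\<Sum>h\<in>H. (L h z - g z)\<^sup>2) \<le> 1"
    and \<epsilon>: "0 < \<epsilon>" "0 < \<eta>" and N: "0 < N" "8 / (\<eta> * \<epsilon>\<^sup>2) \<le> real N"
  shows "samples_suffice M L H \<eta> \<epsilon> N"
proof (rule samples_sufficeI)
  fix D :: "'z measure" assume D: "prob_space D" and sets: "sets D = sets M"
  interpret prob_space D by (rule D)
  interpret P: prob_space "iid N D" by (intro prob_space_PiM D)
  have sp: "space D = space M" using sets by (rule sets_eq_imp_space_eq)
  have meas: "f \<in> borel_measurable D" if "f \<in> borel_measurable M" for f :: "'z \<Rightarrow> real"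
    using that measurable_cong_sets[OF sets refl] by auto
  define dev where "dev f s = (1 / real N) * (\<Sum>n<N. f (s n)) - (\<integral>z. f z \<partial>D)"
    for f :: "'z \<Rightarrow> real" and s :: "nat \<Rightarrow> 'z"
  have dev_eq: "dev f s = (1 / real N) * (\<Sum>n<N. (f (s n) - expectation f))" for f s
    using N by (simp add: dev_def sum_subtractf field_simps)
  \<comment> \<open>The variance of an empirical mean is that of one sample divided by
    \<open>N\<close>, and a variance is at most the raw second moment. Raw second moments can be
    summed over the class by \<open>sq\<close>.\<close>
  have var: "integrable (iid N D) (\<lambda>s. (dev f s)\<^sup>2) \<and> (\<integral>s. (dev f s)\<^sup>2 \<partial>iid N D) \<le> expectation (\<lambda>z. (f z)\<^sup>2) / real N"
    if f: "f \<in> borel_measurable D" "\<And>z. z \<in> space D \<Longrightarrow> \<bar>f z\<bar> \<le> 1" for f :: "'z \<Rightarrow> real"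
  proof -
    note [measurable] = f(1)
    have int: "integrable D f" "integrable D (\<lambda>z. (f z)\<^sup>2)"
      using integrable_bounded_power[OF D f, of 1] integrable_bounded_power[OF D f, of 2] by auto
    define f' where "f' = (\<lambda>z. f z - expectation f)"
    have f': "f' \<in> borel_measurable D" "expectation f' = 0"
      "\<And>z. z \<in> space D \<Longrightarrow> \<bar>f' z\<bar> \<le> 1 + \<bar>expectation f\<bar>"
      using f(2) int by (auto simp: f'_def prob_space intro: order.trans[OF abs_triangle_ineq4])
    have "(dev f s)\<^sup>2 = (1 / real N)\<^sup>2 * (\<Sum>n<N. f' (s n))\<^sup>2" for s
      by (simp add: dev_eq f'_def power_mult_distrib power_divide)
    then have "integrable (iid N D) (\<lambda>s. (dev f s)\<^sup>2)"
      and "(\<integral>s. (dev f s)\<^sup>2 \<partial>iid N D) = (1 / real N)\<^sup>2 * (real N * expectation (\<lambda>z. (f' z)\<^sup>2))"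
      using integrable_sample_sum_power[OF D f'(1,3), of N 2]
        integral_sample_sum_square_centered[OF D f'(1,3,2), of N] by simp_all
    moreover have "expectation (\<lambda>z. (f' z)\<^sup>2) \<le> expectation (\<lambda>z. (f z)\<^sup>2)"
      using variance_eq[OF int] by (simp add: f'_def)
    ultimately show ?thesis using N by (simp add: power2_eq_square field_simps)
  qed
  define f where "f h z = L h z - g z" for h z
  have f: "f h \<in> borel_measurable D" if "h \<in> H" for h
    unfolding f_def using that by (intro meas borel_measurable_diff L g)
  have f1: "\<bar>f h z\<bar> \<le> 1" if "h \<in> H" "z \<in> space D" for h z
  proof -
    have "(f h z)\<^sup>2 \<le> (\<Sum>h\<in>H. (L h z - g z)\<^sup>2)"
      unfolding f_def by (rule member_le_sum) (use H that in auto)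
    also have "\<dots> \<le> 1" using sq that sp by auto
    finally show ?thesis by (simp add: abs_square_le_1)
  qed
  note gvar = var[OF meas[OF g] g1[folded sp]]
  note fvar = var[OF f f1]
  have fint: "integrable D (\<lambda>z. (f h z)\<^sup>2)" if "h \<in> H" for h
    by (rule integrable_bounded_power[OF D f[OF that] f1[OF that]])
  \<comment> \<open>Since \<open>L h = g + f h\<close>, a single bound on \<open>?F\<close> controls
    the common part and all differences at once. Each of the two contributes at most
    \<open>1 / N\<close> to its mean.\<close>
  let ?F = "\<lambda>s. (dev g s)\<^sup>2 + (\<Sum>h\<in>H. (dev (f h) s)\<^sup>2)"
  have intF: "integrable (iid N D) ?F"
    using gvar fvar by (intro Bochner_Integration.integrable_add Bochner_Integration.integrable_sum) auto
  have "(\<Sum>h\<in>H. expectation (\<lambda>z. (f h z)\<^sup>2)) = expectation (\<lambda>z. \<Sum>h\<in>H. (f h z)\<^sup>2)"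
    by (intro Bochner_Integration.integral_sum[symmetric] fint)
  also have "\<dots> \<le> expectation (\<lambda>z. 1)"
    by (intro integral_mono Bochner_Integration.integrable_sum fint) (use sq sp in \<open>auto simp: f_def\<close>)
  finally have 1: "(\<Sum>h\<in>H. expectation (\<lambda>z. (f h z)\<^sup>2)) \<le> 1" by (simp add: prob_space)
  have "expectation (\<lambda>z. (g z)\<^sup>2) \<le> expectation (\<lambda>z. 1)"
    using integrable_bounded_power[OF D meas[OF g] g1[folded sp], of 2] g1 sp
    by (intro integral_mono) (auto simp: abs_square_le_1)
  then have 2: "expectation (\<lambda>z. (g z)\<^sup>2) \<le> 1" by (simp add: prob_space)
  have "(\<integral>s. ?F s \<partial>iid N D) = (\<integral>s. (dev g s)\<^sup>2 \<partial>iid N D) + (\<Sum>h\<in>H. \<integral>s. (dev (f h) s)\<^sup>2 \<partial>iid N D)"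
    using gvar fvar by (subst Bochner_Integration.integral_add) (auto intro!: Bochner_Integration.integral_sum Bochner_Integration.integrable_sum)
  also have "\<dots> \<le> expectation (\<lambda>z. (g z)\<^sup>2) / real N + (\<Sum>h\<in>H. expectation (\<lambda>z. (f h z)\<^sup>2) / real N)"
    using gvar fvar by (intro add_mono sum_mono) auto
  also have "\<dots> \<le> 2 / real N"
    using 1 2 by (simp add: divide_right_mono flip: sum_divide_distrib add_divide_distrib)
  finally have EF: "(\<integral>s. ?F s \<partial>iid N D) \<le> 2 / real N" .
  let ?bad = "{s \<in> space (iid N D). (\<epsilon> / 2)\<^sup>2 \<le> ?F s}"
  show "\<exists>bad\<in>sets (iid N D). P.prob bad \<le> \<eta> \<and>
      (\<forall>s\<in>space (iid N D) - bad. \<forall>h\<in>H. \<bar>expectation (L h) - 1 / real N * (\<Sum>n<N. L h (s n))\<bar> \<le> \<epsilon>)"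
  proof (intro bexI conjI ballI)
    show "?bad \<in> sets (iid N D)"
      using borel_measurable_integrable[OF intF] by measurable
    \<comment> \<open>Markov's inequality at \<open>(\<epsilon> / 2)\<^sup>2\<close> gives
      \<open>8 / (N * \<epsilon>\<^sup>2)\<close>, which explains the \<open>8\<close> in the
      hypothesis on \<open>N\<close>.\<close>
    have "P.prob ?bad \<le> (\<integral>s. ?F s \<partial>iid N D) / (\<epsilon> / 2)\<^sup>2"
      by (rule integral_Markov_inequality_measure[OF intF, where A = "{}"]) (use \<epsilon> in \<open>auto simp: sum_nonneg\<close>)
    also have "\<dots> \<le> (2 / real N) / (\<epsilon> / 2)\<^sup>2" using EF \<epsilon> by (intro divide_right_mono) auto
    also have "\<dots> \<le> \<eta>"
      using N \<epsilon> by (simp add: power2_eq_square field_simps)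
    finally show "P.prob ?bad \<le> \<eta>" .
    fix s h assume s: "s \<in> space (iid N D) - ?bad" and h: "h \<in> H"
    have F: "?F s < (\<epsilon> / 2)\<^sup>2" using s by auto
    have sn: "s n \<in> space D" if "n < N" for n using s that by (auto simp: space_PiM PiE_iff)
    have "(dev g s)\<^sup>2 \<le> ?F s" by (simp add: sum_nonneg)
    then have a: "\<bar>dev g s\<bar> \<le> \<epsilon> / 2"
      using F \<epsilon> abs_le_square_iff[of "dev g s" "\<epsilon> / 2"] by simp
    have "(dev (f h) s)\<^sup>2 \<le> (\<Sum>h\<in>H. (dev (f h) s)\<^sup>2)" by (rule member_le_sum) (use H h in auto)
    then have "(dev (f h) s)\<^sup>2 \<le> ?F s" by (simp add: add_increasing)
    then have b: "\<bar>dev (f h) s\<bar> \<le> \<epsilon> / 2"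
      using F \<epsilon> abs_le_square_iff[of "dev (f h) s" "\<epsilon> / 2"] by simp
    have "integrable D g" "integrable D (f h)"
      using integrable_bounded_power[OF D f[OF h] f1[OF h], of 1]
        integrable_bounded_power[OF D meas[OF g] g1[folded sp], of 1] by auto
    then have "expectation (L h) = expectation g + expectation (f h)"
      by (subst Bochner_Integration.integral_add[symmetric]) (auto simp: f_def)
    then have "expectation (L h) - 1 / real N * (\<Sum>n<N. L h (s n)) = - (dev g s + dev (f h) s)"
      using N by (simp add: dev_def f_def[abs_def] sum_subtractf field_simps)
    then show "\<bar>expectation (L h) - 1 / real N * (\<Sum>n<N. L h (s n))\<bar> \<le> \<epsilon>"
      using a b by linarith
  qed
qed

text \<open>Hoeffding's inequality and a union bound: the failure probability is at most
  \<open>2 * card H * exp (- 2 * N * \<epsilon>\<^sup>2)\<close>, so the cardinality enters only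
  through its logarithm.\<close>

lemma samples_suffice_hoeffding:
  assumes L01: "\<And>h z. h \<in> H \<Longrightarrow> z \<in> space M \<Longrightarrow> L h z \<in> {0..1}"
    and \<epsilon>: "0 < \<epsilon>" "0 < \<eta>" and N: "0 < N" "ln (2 * real (card H) / \<eta>) \<le> 2 * real N * \<epsilon>\<^sup>2"
  shows "samples_suffice M L H \<eta> \<epsilon> N"
proof (rule samples_sufficeI)
  fix D :: "'z measure" assume D: "prob_space D" and sets: "sets D = sets M"
  interpret prob_space D by (rule D)
  interpret P: prob_space "iid N D" by (intro prob_space_PiM D)
  have sp: "space D = space M" using sets by (rule sets_eq_imp_space_eq)
  have meas [measurable]: "L h \<in> borel_measurable D" if "h \<in> H" for h
    using L[OF that] measurable_cong_sets[OF sets refl] by auto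
  have comp: "distr (iid N D) D (\<lambda>s. s n) = D" if "n < N" for n
    using distr_PiM_component[of "{..<N}" "\<lambda>_. D" n] D that by auto
  \<comment> \<open>The coordinates are independent because their joint distribution is the product
    measure itself.\<close>
  have "P.indep_vars (\<lambda>_. D) (\<lambda>n s. s n) {..<N}"
  proof (subst P.indep_vars_iff_distr_eq_PiM')
    have "distr (iid N D) (iid N D) (\<lambda>x. restrict x {..<N}) = distr (iid N D) (iid N D) (\<lambda>x. x)"
      by (intro distr_cong) (auto simp: space_PiM PiE_restrict)
    also have "\<dots> = iid N D" by simp
    also have "\<dots> = Pi\<^sub>M {..<N} (\<lambda>i. distr (iid N D) D (\<lambda>f. f i))"
      by (intro PiM_cong) (auto simp: comp)
    finally show "distr (iid N D) (iid N D) (\<lambda>x. \<lambda>i\<in>{..<N}. x i) =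
        Pi\<^sub>M {..<N} (\<lambda>i. distr (iid N D) D (\<lambda>f. f i))" by simp
  qed (use N in auto)
  then have ind: "P.indep_vars (\<lambda>_. borel) (\<lambda>n s. L h (s n)) {..<N}" if "h \<in> H" for h
    by (rule P.indep_vars_compose2[where Y = "\<lambda>_. L h"]) (use that in measurable)
  let ?B = "\<lambda>h. {s \<in> space (iid N D). real N * \<epsilon> \<le> \<bar>(\<Sum>n<N. L h (s n)) - real N * expectation (L h)\<bar>}"
  have hoeff: "P.prob (?B h) \<le> 2 * exp (- 2 * real N * \<epsilon>\<^sup>2)" if h: "h \<in> H" for h
  proof -
    have "P.expectation (\<lambda>s. L h (s n)) = expectation (L h)" if "n < N" for n
      using h that by (subst (2) comp[OF that, symmetric]) (simp add: integral_distr)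
    then have \<mu>: "(\<Sum>n<N. P.expectation (\<lambda>s. L h (s n))) = real N * expectation (L h)" by simp
    interpret X: Hoeffding_ineq "iid N D" "{..<N}" "\<lambda>n s. L h (s n)" "\<lambda>_. 0" "\<lambda>_. 1"
        "\<Sum>n<N. P.expectation (\<lambda>s. L h (s n))"
    proof unfold_locales
      fix n assume "n \<in> {..<N}"
      then show "AE s in iid N D. L h (s n) \<in> {0..1}"
        using L01[OF h] sp by (intro AE_I2) (auto simp: space_PiM PiE_iff)
    qed (use ind[OF h] in auto)
    have "- 2 * (real N * \<epsilon>)\<^sup>2 / real N = - 2 * real N * \<epsilon>\<^sup>2"
      using N by (simp add: power2_eq_square)
    then show ?thesis using X.Hoeffding_ineq_abs_ge[of "real N * \<epsilon>"] \<epsilon> N \<mu> by simp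
  qed
  show "\<exists>bad\<in>sets (iid N D). P.prob bad \<le> \<eta> \<and>
      (\<forall>s\<in>space (iid N D) - bad. \<forall>h\<in>H. \<bar>expectation (L h) - 1 / real N * (\<Sum>n<N. L h (s n))\<bar> \<le> \<epsilon>)"
  proof (intro bexI[of _ "\<Union>h\<in>H. ?B h"] conjI ballI)
    have B: "?B h \<in> sets (iid N D)" if "h \<in> H" for h using that by measurable
    then show "(\<Union>h\<in>H. ?B h) \<in> sets (iid N D)" using H by auto
    have "P.prob (\<Union>h\<in>H. ?B h) \<le> (\<Sum>h\<in>H. P.prob (?B h))"
      using H B by (intro P.finite_measure_subadditive_finite) auto
    also have "\<dots> \<le> (\<Sum>h\<in>H. 2 * exp (- 2 * real N * \<epsilon>\<^sup>2))" by (intro sum_mono hoeff)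
    also have "\<dots> = 2 * real (card H) * exp (- 2 * real N * \<epsilon>\<^sup>2)" by simp
    also have "\<dots> \<le> \<eta>"
    proof -
      have c: "0 < real (card H)" using H by (simp add: card_gt_0_iff)
      have "2 * real (card H) / \<eta> = exp (ln (2 * real (card H) / \<eta>))" using c \<epsilon> by simp
      also have "\<dots> \<le> exp (2 * real N * \<epsilon>\<^sup>2)" using N by simp
      finally show ?thesis using \<epsilon> by (simp add: field_simps exp_minus)
    qed
    finally show "P.prob (\<Union>h\<in>H. ?B h) \<le> \<eta>" .
    fix s h assume s: "s \<in> space (iid N D) - (\<Union>h\<in>H. ?B h)" and h: "h \<in> H"
    then have "\<bar>(\<Sum>n<N. L h (s n)) - real N * expectation (L h)\<bar> < real N * \<epsilon>" by auto
    moreover have "(\<Sum>n<N. L h (s n)) - real N * expectation (L h) =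
        - real N * (expectation (L h) - 1 / real N * (\<Sum>n<N. L h (s n)))"
      using N by (simp add: field_simps)
    ultimately show "\<bar>expectation (L h) - 1 / real N * (\<Sum>n<N. L h (s n))\<bar> \<le> \<epsilon>"
      using N by (simp add: abs_mult)
  qed
qed

end

text \<open>Models one labelled sample: it falls into the \<open>i\<close>-th of \<open>k\<close>
  pairs with probability \<open>1 / k\<close>, where \<open>\<xi> i\<close> is nonzero, and the fair
  sign tells which of the two points was hit.\<close>

definition sign_family :: "'z measure \<Rightarrow> nat \<Rightarrow> (nat \<Rightarrow> 'z \<Rightarrow> real) \<Rightarrow> bool" where
  "sign_family D k \<xi> \<longleftrightarrow> prob_space D \<and>
     (\<forall>i<k. \<xi> i \<in> borel_measurable D \<and> (\<forall>z\<in>space D. \<xi> i z \<in> {-1, 0, 1}) \<and>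
        (\<integral>z. \<xi> i z \<partial>D) = 0 \<and> (\<integral>z. (\<xi> i z)\<^sup>2 \<partial>D) = 1 / real k)"

lemma sign_familyD:
  assumes "sign_family D k \<xi>"
  shows "prob_space D"
    and "\<And>i. i < k \<Longrightarrow> \<xi> i \<in> borel_measurable D"
    and "\<And>i z. i < k \<Longrightarrow> z \<in> space D \<Longrightarrow> \<xi> i z \<in> {-1, 0, 1}"
    and "\<And>i. i < k \<Longrightarrow> (\<integral>z. \<xi> i z \<partial>D) = 0"
    and "\<And>i. i < k \<Longrightarrow> (\<integral>z. (\<xi> i z)\<^sup>2 \<partial>D) = 1 / real k"
  using assms unfolding sign_family_def by auto

lemma sign_family_integrable:
  assumes "sign_family D k \<xi>" "i < k"
  shows "integrable D (\<xi> i)"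
proof -
  note F = sign_familyD[OF assms(1)]
  interpret prob_space D by (rule F)
  have "\<bar>\<xi> i z\<bar> \<le> 1" if "z \<in> space D" for z
    using F(3)[OF assms(2) that] by auto
  then show ?thesis
    by (intro integrable_const_bound[where B = 1] AE_I2 F(2) assms(2)) auto
qed

lemma AE_iid:
  assumes "prob_space D" "AE z in D. P z"
  shows "AE s in iid N D. \<forall>n<N. P (s n)"
proof -
  have "AE s in iid N D. \<forall>n\<in>{..<N}. P (s n)"
    by (intro eventually_ball_finite ballI AE_PiM_component assms) auto
  then show ?thesis by (simp only: Ball_def lessThan_iff)
qed

text \<open>All hypotheses share the loss of one fair coin, so minimizing has no effect and the
  deviation of the optimal values is that of the coin's empirical mean.\<close>

lemma not_samples_suffice_coin:
  assumes F: "sign_family D 1 (\<lambda>_. \<xi>)" and sets: "sets D = sets M" and H: "H \<noteq> {}"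
    and L: "AE z in D. \<forall>h\<in>H. L h z = 1/2 + \<xi> z / 2"
    and Lm: "\<And>h. h \<in> H \<Longrightarrow> L h \<in> borel_measurable M"
    and \<eta>: "\<eta> < 1/4" and \<epsilon>: "0 < \<epsilon>" and N: "0 < N" "real N \<le> 1 / (40 * \<epsilon>\<^sup>2)"
  shows "\<not> samples_suffice M L H \<eta> \<epsilon> N"
proof (rule not_samples_suffice)
  note F1 = sign_familyD(1)[OF F] sign_familyD(2-)[OF F, of 0, simplified]
  note [measurable] = F1(2)
  interpret prob_space D by (rule F1(1))
  let ?bad = "{s \<in> space (iid N D). (\<Sum>n<N. \<xi> (s n))\<^sup>2 > real N / 10}"
  show "prob_space D" "sets D = sets M" "\<eta> < 1/4" by (rule F1(1) sets \<eta>)+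
  show "?bad \<in> sets (iid N D)" by measurable
  show "1/4 \<le> measure (iid N D) ?bad"
    by (rule sign_sum_anti_concentration) (use F1 N in auto)
  have Lmeas: "L h \<in> borel_measurable D" if "h \<in> H" for h
    using Lm[OF that] measurable_cong_sets[OF sets refl] by auto
  have int: "integrable D \<xi>" using sign_family_integrable[OF F, of 0] by simp
  have "(\<integral>z. L h z \<partial>D) = 1/2" if h: "h \<in> H" for h
  proof -
    have "(\<integral>z. L h z \<partial>D) = (\<integral>z. 1/2 + \<xi> z / 2 \<partial>D)"
      by (rule integral_cong_AE) (use L h Lmeas in auto)
    also have "\<dots> = 1/2" using F1(4) int by (simp add: prob_space)
    finally show ?thesis .
  qed
  then have "(\<lambda>h. \<integral>z. L h z \<partial>D) ` H = {1/2}" using H by (force simp: image_iff)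
  then have opt: "opt_value L H D = 1/2" by (simp add: opt_value_def)
  have "AE s in iid N D. \<forall>n<N. \<forall>h\<in>H. L h (s n) = 1/2 + \<xi> (s n) / 2"
    by (rule AE_iid[OF F1(1) L])
  then show "AE s in iid N D. s \<in> ?bad \<longrightarrow> \<epsilon> < \<bar>opt_value L H D - emp_opt_value L H N s\<bar>"
  proof eventually_elim
    case (elim s)
    have "(1 / real N) * (\<Sum>n<N. L h (s n)) = 1/2 + (\<Sum>n<N. \<xi> (s n)) / (2 * real N)" if "h \<in> H" for h
    proof -
      have "(\<Sum>n<N. L h (s n)) = (\<Sum>n<N. 1/2 + \<xi> (s n) / 2)"
        using elim that by (intro sum.cong) auto
      also have "\<dots> = real N / 2 + (\<Sum>n<N. \<xi> (s n)) / 2"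
        by (simp add: sum.distrib sum_divide_distrib)
      finally show ?thesis using N by (simp add: field_simps)
    qed
    then have emp: "emp_opt_value L H N s = 1/2 + (\<Sum>n<N. \<xi> (s n)) / (2 * real N)"
      using H by (simp add: emp_opt_value_def)
    show ?case
    proof
      assume "s \<in> ?bad"
      then have S: "(\<Sum>n<N. \<xi> (s n))\<^sup>2 > real N / 10" by simp
      \<comment> \<open>The constant is \<open>40 = 4 * 10\<close>: the deviation is
        \<open>\<bar>S\<bar> / (2 * N)\<close> for the sign sum \<open>S\<close>, and
        \<open>S\<^sup>2 > N / 10\<close> on the bad event.\<close>
      have "40 * real N * \<epsilon>\<^sup>2 \<le> 1" using N \<epsilon> by (simp add: field_simps)
      then have "real N * (40 * real N * \<epsilon>\<^sup>2) \<le> real N * 1" by (intro mult_left_mono) auto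
      then have "(2 * real N * \<epsilon>)\<^sup>2 \<le> real N / 10" by (simp add: power2_eq_square algebra_simps)
      then have "(2 * real N * \<epsilon>)\<^sup>2 < \<bar>\<Sum>n<N. \<xi> (s n)\<bar>\<^sup>2" using S by simp
      then have "2 * real N * \<epsilon> < \<bar>\<Sum>n<N. \<xi> (s n)\<bar>" by (rule power_less_imp_less_base) simp
      then show "\<epsilon> < \<bar>opt_value L H D - emp_opt_value L H N s\<bar>"
        unfolding opt emp using N by (simp add: field_simps abs_mult)
    qed
  qed
qed

text \<open>Over a cube of hypotheses the empirical minimum picks the minority side in each group.\<close>

lemma cube_deviation:
  assumes F: "sign_family D k \<xi>" and sets: "sets D = sets M" and k: "k \<le> m"
    and H: "H = hh ` Pow {..<m}"
    and L: "AE z in D. \<forall>b\<in>Pow {..<m}.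
        L (hh b) z = 1/2 + (\<Sum>i<k. (if i \<in> b then 1 else - 1) * \<xi> i z) / 2"
    and Lm: "\<And>h. h \<in> H \<Longrightarrow> L h \<in> borel_measurable M" and N: "0 < N"
  shows "AE s in iid N D.
    (\<Sum>i<k. \<bar>\<Sum>n<N. \<xi> i (s n)\<bar>) / (2 * real N) \<le> \<bar>opt_value L H D - emp_opt_value L H N s\<bar>"
proof -
  note F1 = sign_familyD[OF F]
  interpret prob_space D by (rule F1(1))
  have Lmeas: "L (hh b) \<in> borel_measurable D" if "b \<in> Pow {..<m}" for b
    using Lm[of "hh b"] that H measurable_cong_sets[OF sets refl] by auto
  note int = sign_family_integrable[OF F]
  have "(\<integral>z. L (hh b) z \<partial>D) = 1/2" if b: "b \<in> Pow {..<m}" for b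
  proof -
    have "(\<integral>z. L (hh b) z \<partial>D) = (\<integral>z. 1/2 + (\<Sum>i<k. (if i \<in> b then 1 else - 1) * \<xi> i z) / 2 \<partial>D)"
    proof (rule integral_cong_AE)
      show "(\<lambda>z. 1/2 + (\<Sum>i<k. (if i \<in> b then 1 else - 1) * \<xi> i z) / 2) \<in> borel_measurable D"
        using F1(2) by (intro borel_measurable_add borel_measurable_divide borel_measurable_sum) auto
    qed (use L b Lmeas in auto)
    also have "\<dots> = (\<integral>z. 1/2 \<partial>D) + (\<integral>z. (\<Sum>i<k. (if i \<in> b then 1 else - 1) * \<xi> i z) / 2 \<partial>D)"
      by (intro Bochner_Integration.integral_add Bochner_Integration.integrable_divide
          Bochner_Integration.integrable_sum integrable_mult_right int) auto
    also have "(\<integral>z. (\<Sum>i<k. (if i \<in> b then 1 else - 1) * \<xi> i z) / 2 \<partial>D) =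
        (\<Sum>i<k. \<integral>z. (if i \<in> b then 1 else - 1) * \<xi> i z \<partial>D) / 2"
      by (subst integral_divide_zero, subst Bochner_Integration.integral_sum)
         (auto intro!: integrable_mult_right int)
    also have "(\<Sum>i<k. \<integral>z. (if i \<in> b then 1 else - 1) * \<xi> i z \<partial>D) = 0"
      by (rule sum.neutral) (simp add: F1(4))
    also have "(\<integral>z. 1/2 \<partial>D) + 0 / 2 = (1/2 :: real)" by (simp add: prob_space)
    finally show ?thesis .
  qed
  then have "(\<lambda>h. \<integral>z. L h z \<partial>D) ` H = {1/2}" unfolding H image_image by (intro set_eqI) (force simp: image_iff)
  then have opt: "opt_value L H D = 1/2" by (simp add: opt_value_def)
  from AE_iid[OF F1(1) L] show ?thesis
  proof eventually_elim
    case (elim s)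
    \<comment> \<open>This corner of the cube turns every group contribution into minus its absolute
      value; \<open>k \<le> m\<close> puts it in the class.\<close>
    define b where "b = {i. i < k \<and> (\<Sum>n<N. \<xi> i (s n)) < 0}"
    have b: "b \<in> Pow {..<m}" using k by (auto simp: b_def)
    have "(\<Sum>n<N. L (hh b) (s n)) =
        (\<Sum>n<N. 1/2 + (\<Sum>i<k. (if i \<in> b then 1 else - 1) * \<xi> i (s n)) / 2)"
      using elim b by (intro sum.cong) auto
    also have "\<dots> = real N / 2 + (\<Sum>n<N. \<Sum>i<k. (if i \<in> b then 1 else - 1) * \<xi> i (s n)) / 2"
      by (simp add: sum.distrib sum_divide_distrib)
    also have "(\<Sum>n<N. \<Sum>i<k. (if i \<in> b then 1 else - 1) * \<xi> i (s n)) =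
        (\<Sum>i<k. (if i \<in> b then 1 else - 1) * (\<Sum>n<N. \<xi> i (s n)))"
      by (subst sum.swap) (simp only: sum_distrib_left)
    also have "\<dots> = (\<Sum>i<k. - \<bar>\<Sum>n<N. \<xi> i (s n)\<bar>)"
      by (intro sum.cong) (auto simp: b_def)
    finally have "(1 / real N) * (\<Sum>n<N. L (hh b) (s n)) =
        1/2 - (\<Sum>i<k. \<bar>\<Sum>n<N. \<xi> i (s n)\<bar>) / (2 * real N)"
      using N by (simp add: sum_negf field_simps)
    moreover have "emp_opt_value L H N s \<le> (1 / real N) * (\<Sum>n<N. L (hh b) (s n))"
      unfolding emp_opt_value_def by (rule cINF_lower) (use b H in auto)
    ultimately show ?case using opt by simp
  qed
qed

text \<open>If \<open>10 \<le> N < 10 * m\<close> then only \<open>N div 10\<close> groups are used, so that each still receives at least ten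
  samples on average; this keeps the constant in the Paley-Zygmund inequality above \<open>1/4\<close>. For
  \<open>N < 10\<close> a single group is enough.\<close>

lemma not_samples_suffice_cube:
  assumes fam: "\<And>k. 0 < k \<Longrightarrow> k \<le> m \<Longrightarrow> \<exists>D \<xi>. sign_family D k \<xi> \<and> sets D = sets M \<and>
      (AE z in D. \<forall>b\<in>Pow {..<m}.
        L (hh b) z = 1/2 + (\<Sum>i<k. (if i \<in> b then 1 else - 1) * \<xi> i z) / 2)"
    and H: "H = hh ` Pow {..<m}" and m: "0 < m"
    and Lm: "\<And>h. h \<in> H \<Longrightarrow> L h \<in> borel_measurable M"
    and \<eta>: "\<eta> < 1/4" and \<epsilon>: "0 < \<epsilon>" "\<epsilon> \<le> 1/200"
    and N: "0 < N" "real N \<le> real m / (2000 * \<epsilon>\<^sup>2)"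
  shows "\<not> samples_suffice M L H \<eta> \<epsilon> N"
proof -
  \<comment> \<open>The bad event forces a deviation above \<open>1 / (20 * w)\<close> with
    \<open>w\<^sup>2 = 31/10 * (N / k)\<close>. As \<open>400 * 31/10 = 1240\<close>, the last
    assumption says that this exceeds \<open>\<epsilon>\<close>.\<close>
  have main: "\<not> samples_suffice M L H \<eta> \<epsilon> N"
    if k: "0 < k" "k \<le> m" "10 * k \<le> N" "1240 * \<epsilon>\<^sup>2 * (real N / real k) < 1" for k
  proof -
    obtain D \<xi> where F: "sign_family D k \<xi>" and sets: "sets D = sets M"
      and L: "AE z in D. \<forall>b\<in>Pow {..<m}.
        L (hh b) z = 1/2 + (\<Sum>i<k. (if i \<in> b then 1 else - 1) * \<xi> i z) / 2"
      using fam[OF k(1,2)] by blast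
    note F1 = sign_familyD[OF F]
    have dev: "AE s in iid N D. (\<Sum>i<k. \<bar>\<Sum>n<N. \<xi> i (s n)\<bar>) / (2 * real N) \<le>
        \<bar>opt_value L H D - emp_opt_value L H N s\<bar>"
      by (rule cube_deviation[OF F sets k(2) H L Lm N(1)])
    define w where "w = sqrt (31/10 * (real N / real k))"
    have w: "0 < w" "w\<^sup>2 = 31/10 * (real N / real k)" using N k by (auto simp: w_def)
    have "(20 * \<epsilon> * w)\<^sup>2 = 1240 * \<epsilon>\<^sup>2 * (real N / real k)"
      by (simp add: power_mult_distrib w(2))
    also have "\<dots> < 1\<^sup>2" using k by simp
    finally have \<epsilon>w: "20 * \<epsilon> * w < 1" by (rule power_less_imp_less_base) simp
    let ?W = "\<lambda>s. (\<Sum>i<k. \<bar>\<Sum>n<N. \<xi> i (s n)\<bar>)"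
    let ?bad = "{s \<in> space (iid N D). ?W s > real N / (10 * w)}"
    have [measurable]: "?W \<in> borel_measurable (iid N D)"
    proof (rule borel_measurable_sum)
      fix i assume "i \<in> {..<k}"
      then have [measurable]: "\<xi> i \<in> borel_measurable D" using F1(2) by simp
      show "(\<lambda>s. \<bar>\<Sum>n<N. \<xi> i (s n)\<bar>) \<in> borel_measurable (iid N D)" by measurable
    qed
    show ?thesis
    proof (rule not_samples_suffice)
      show "prob_space D" "sets D = sets M" "\<eta> < 1/4" by (rule F1(1) sets \<eta>)+
      show "?bad \<in> sets (iid N D)" by measurable
      show "1/4 \<le> measure (iid N D) ?bad"
        unfolding w_def by (rule sum_abs_sign_sums_anti_concentration) (use F1 k in auto)
      from dev show "AE s in iid N D. s \<in> ?bad \<longrightarrow> \<epsilon> < \<bar>opt_value L H D - emp_opt_value L H N s\<bar>"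
      proof eventually_elim
        case (elim s)
        show ?case
        proof
          assume "s \<in> ?bad"
          then have "real N / (10 * w) / (2 * real N) < ?W s / (2 * real N)"
            using N by (intro divide_strict_right_mono) auto
          moreover have "\<epsilon> < real N / (10 * w) / (2 * real N)"
            using \<epsilon>w w N by (simp add: field_simps)
          ultimately show "\<epsilon> < \<bar>opt_value L H D - emp_opt_value L H N s\<bar>" using elim by linarith
        qed
      qed
    qed
  qed
  consider "N < 10" | "10 * m \<le> N" | "10 \<le> N" "N < 10 * m" by linarith
  then show ?thesis
  proof cases
    case 2
    have "real N / real m \<le> 1 / (2000 * \<epsilon>\<^sup>2)"
      using N m by (simp add: field_simps)
    then have "1240 * \<epsilon>\<^sup>2 * (real N / real m) \<le> 1240 * \<epsilon>\<^sup>2 * (1 / (2000 * \<epsilon>\<^sup>2))"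
      using \<epsilon> by (intro mult_left_mono) auto
    also have "\<dots> < 1" using \<epsilon> by simp
    finally show ?thesis using 2 m by (intro main) auto
  next
    case 3
    define k where "k = N div 10"
    have k: "0 < k" "k \<le> m" "10 * k \<le> N" "N \<le> 20 * k"
      using 3 unfolding k_def by presburger+
    \<comment> \<open>Rounding down at most doubles the ten samples per group. With at most twenty
      of them, \<open>\<epsilon> \<le> 1/200\<close> alone makes the deviation large enough.\<close>
    have "real N \<le> 20 * real k" using k(4) by linarith
    then have "real N / real k \<le> 20" using k(1) by (simp add: field_simps)
    moreover have "\<epsilon>\<^sup>2 \<le> (1/200)\<^sup>2" using \<epsilon> by (intro power_mono) auto
    ultimately have "1240 * \<epsilon>\<^sup>2 * (real N / real k) \<le> 1240 * (1/200)\<^sup>2 * 20"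
      by (intro mult_mono) auto
    also have "\<dots> < 1" by (simp add: power2_eq_square)
    finally show ?thesis using k by (intro main) auto
  next
    case 1
    obtain D \<xi> where F: "sign_family D 1 \<xi>" and sets: "sets D = sets M"
      and L: "AE z in D. \<forall>b\<in>Pow {..<m}.
        L (hh b) z = 1/2 + (\<Sum>i<1. (if i \<in> b then 1 else - 1) * \<xi> i z) / 2"
      using fam[of 1] m by auto
    note F1 = sign_familyD(1)[OF F] sign_familyD(2-)[OF F, of 0, simplified]
    note [measurable] = F1(2)
    have m1: "1 \<le> m" using m by simp
    have dev: "AE s in iid N D. (\<Sum>i<1. \<bar>\<Sum>n<N. \<xi> i (s n)\<bar>) / (2 * real N) \<le>
        \<bar>opt_value L H D - emp_opt_value L H N s\<bar>"
      by (rule cube_deviation[OF F sets m1 H L Lm N(1)])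
    let ?bad = "{s \<in> space (iid N D). (\<Sum>n<N. \<xi> 0 (s n))\<^sup>2 > real N / 10}"
    show ?thesis
    proof (rule not_samples_suffice)
      show "prob_space D" "sets D = sets M" "\<eta> < 1/4" by (rule F1(1) sets \<eta>)+
      show "?bad \<in> sets (iid N D)" by measurable
      show "1/4 \<le> measure (iid N D) ?bad"
        by (rule sign_sum_anti_concentration) (use F1 N in auto)
      from dev show "AE s in iid N D. s \<in> ?bad \<longrightarrow> \<epsilon> < \<bar>opt_value L H D - emp_opt_value L H N s\<bar>"
      proof eventually_elim
        case (elim s)
        show ?case
        proof
          assume "s \<in> ?bad"
          then have S: "real N / 10 < \<bar>\<Sum>n<N. \<xi> 0 (s n)\<bar>\<^sup>2" by simp
          \<comment> \<open>For fewer than ten samples the bad event gives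
            \<open>\<bar>S\<bar> > N / 10\<close> for the sign sum \<open>S\<close>, hence a
            deviation above \<open>1/20\<close>, whatever \<open>N\<close> is.\<close>
          have "real N * real N \<le> real N * 10" using 1 by (intro mult_left_mono) auto
          then have "(real N / 10)\<^sup>2 \<le> real N / 10" by (simp add: power2_eq_square)
          then have "(real N / 10)\<^sup>2 < \<bar>\<Sum>n<N. \<xi> 0 (s n)\<bar>\<^sup>2" using S by linarith
          then have "real N / 10 < \<bar>\<Sum>n<N. \<xi> 0 (s n)\<bar>" by (rule power_less_imp_less_base) simp
          then have "1 / 20 < \<bar>\<Sum>n<N. \<xi> 0 (s n)\<bar> / (2 * real N)" using N by (simp add: field_simps)
          then show "\<epsilon> < \<bar>opt_value L H D - emp_opt_value L H N s\<bar>" using elim \<epsilon> by simp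
        qed
      qed
    qed
  qed
qed

text \<open>One sufficient size makes the infimum finite and attained, since \<open>enat\<close> is
  well-ordered. The lower bound has to exclude every smaller size, as monotonicity of sufficiency in
  \<open>N\<close> is not established.\<close>

lemma sample_complexity_within_factors:
  assumes lower: "\<And>N. 0 < N \<Longrightarrow> real N < c * g \<Longrightarrow> \<not> samples_suffice M L H \<eta> \<epsilon> N"
    and upper: "0 < N\<^sub>0" "samples_suffice M L H \<eta> \<epsilon> N\<^sub>0" "real N\<^sub>0 \<le> C * g"
  shows "within_factors c C (sample_complexity M L H \<eta> \<epsilon>) g"
proof -
  let ?S = "{N. 0 < N \<and> samples_suffice M L H \<eta> \<epsilon> N}"
  have "enat N\<^sub>0 \<in> enat ` ?S" using upper by auto
  then have "Inf (enat ` ?S) \<in> enat ` ?S" by (rule wellorder_InfI)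
  then obtain N where N: "N \<in> ?S" "sample_complexity M L H \<eta> \<epsilon> = enat N"
    by (auto simp: sample_complexity_def)
  have "enat N \<le> enat N\<^sub>0"
    unfolding N(2)[symmetric] sample_complexity_def by (rule INF_lower) (use upper in auto)
  moreover have "c * g \<le> real N" using lower[of N] N by force
  ultimately show ?thesis
    using upper by (auto simp: within_factors_def N(2))
qed

text \<open>At most one term is nonzero; this supplies the variance hypothesis of the Chebyshev
  bound for disjoint regions.\<close>

lemma finite_sq_sum_le_1:
  fixes f :: "'h \<Rightarrow> real"
  assumes "finite H" "\<And>h. h \<in> H \<Longrightarrow> \<bar>f h\<bar> \<le> 1"
    and "\<And>h h'. h \<in> H \<Longrightarrow> h' \<in> H \<Longrightarrow> f h \<noteq> 0 \<Longrightarrow> f h' \<noteq> 0 \<Longrightarrow> h = h'"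
  shows "(\<Sum>h\<in>H. (f h)\<^sup>2) \<le> 1"
proof (cases "\<exists>h\<in>H. f h \<noteq> 0")
  case True
  then obtain h where h: "h \<in> H" "f h \<noteq> 0" by blast
  have "(\<Sum>h\<in>H. (f h)\<^sup>2) = (\<Sum>h\<in>{h}. (f h)\<^sup>2)"
    using assms h by (intro sum.mono_neutral_right) auto
  also have "\<dots> \<le> 1" using assms(2)[OF h(1)] by (simp add: abs_square_le_1)
  finally show ?thesis .
qed simp

section \<open>Losses on the data space\<close>

text \<open>The 0-1 loss exceeds \<open>u\<close> everywhere for \<open>u < 0\<close>, on the error
  set for \<open>0 \<le> u < 1\<close>, and nowhere otherwise. As \<open>\<rho> < 1\<close> excludes
  negative \<open>u\<close>, the admissible levels form a half-line starting at \<open>0\<close> or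
  \<open>1\<close>.\<close>

lemma robust_loss_eq:
  assumes "prob_space r" and \<rho>: "0 \<le> \<rho>" "\<rho> < 1"
  shows "robust_loss \<rho> r h (x, y) =
    (if measure r {\<delta> \<in> space r. h (x + \<delta>) \<noteq> y} \<le> \<rho> then 0 else 1)"
proof -
  interpret prob_space r by fact
  let ?q = "measure r {\<delta> \<in> space r. h (x + \<delta>) \<noteq> y}"
  have exceed: "measure r {\<delta> \<in> space r. zero_one_loss (h (x + \<delta>)) y > u} =
      (if u < 0 then 1 else if u < 1 then ?q else 0)" for u
  proof -
    have "{\<delta> \<in> space r. zero_one_loss (h (x + \<delta>)) y > u} =
        (if u < 0 then space r else if u < 1 then {\<delta> \<in> space r. h (x + \<delta>) \<noteq> y} else {})"
      by (auto simp: zero_one_loss_def)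
    then show ?thesis by (simp add: prob_space)
  qed
  have "{u. measure r {\<delta> \<in> space r. zero_one_loss (h (x + \<delta>)) y > u} \<le> \<rho>} =
      (if ?q \<le> \<rho> then {0..} else {1..})"
    unfolding exceed using \<rho> by auto
  then show ?thesis by (simp add: robust_loss_def rho_esssup_def)
qed

text \<open>The loss thresholds the mass of a section of the error set in the product with
  \<open>r\<close>, and section masses depend measurably on the base point.\<close>

lemma borel_measurable_robust_loss:
  fixes r :: "'a :: euclidean_space measure"
  assumes r: "prob_space r" "sets r = sets (restrict_space borel \<Delta>)"
    and X: "\<And>x \<delta>. x \<in> X \<Longrightarrow> \<delta> \<in> \<Delta> \<Longrightarrow> x + \<delta> \<in> X"
    and h: "h \<in> restrict_space borel X \<rightarrow>\<^sub>M count_space Y" and Y: "finite Y"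
    and \<rho>: "0 \<le> \<rho>" "\<rho> < 1"
  shows "robust_loss \<rho> r h \<in> borel_measurable (data_space X Y)"
proof -
  interpret prob_space r by fact
  let ?D = "data_space X Y"
  have sp: "space ?D = X \<times> Y" "space r = \<Delta>"
    using sets_eq_imp_space_eq[OF r(2)]
    by (auto simp: data_space_def space_pair_measure space_restrict_space)
  have fstD: "fst \<in> ?D \<rightarrow>\<^sub>M restrict_space borel X" and sndD: "snd \<in> ?D \<rightarrow>\<^sub>M count_space Y"
    by (simp_all add: data_space_def)
  have id_r: "(\<lambda>x. x) \<in> borel_measurable r"
    by (subst measurable_cong_sets[OF r(2) refl], rule measurable_restrict_space1) simp
  have id_X: "(\<lambda>x. x) \<in> borel_measurable (restrict_space borel X)"
    by (rule measurable_restrict_space1) simp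
  have fst_fst: "(\<lambda>p. fst (fst p)) \<in> ?D \<Otimes>\<^sub>M r \<rightarrow>\<^sub>M restrict_space borel X"
    by (rule measurable_compose[OF measurable_fst fstD])
  have "(\<lambda>p. fst (fst p) + snd p) \<in> ?D \<Otimes>\<^sub>M r \<rightarrow>\<^sub>M restrict_space borel X"
  proof (rule measurable_restrict_space2)
    show "(\<lambda>p. fst (fst p) + snd p) \<in> space (?D \<Otimes>\<^sub>M r) \<rightarrow> X"
      using X sp by (auto simp: space_pair_measure)
    show "(\<lambda>p. fst (fst p) + snd p) \<in> borel_measurable (?D \<Otimes>\<^sub>M r)"
      using measurable_compose[OF fst_fst id_X] measurable_compose[OF measurable_snd id_r]
      by (intro borel_measurable_add) auto
  qed
  then have G1: "(\<lambda>p. h (fst (fst p) + snd p)) \<in> ?D \<Otimes>\<^sub>M r \<rightarrow>\<^sub>M count_space Y"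
    using h by (rule measurable_compose)
  have G2: "(\<lambda>p. snd (fst p)) \<in> ?D \<Otimes>\<^sub>M r \<rightarrow>\<^sub>M count_space Y"
    by (rule measurable_compose[OF measurable_fst sndD])
  let ?G = "\<lambda>p. (h (fst (fst p) + snd p), snd (fst p))"
  let ?N = "{u \<in> Y \<times> Y. fst u \<noteq> snd u}"
  have "?G \<in> ?D \<Otimes>\<^sub>M r \<rightarrow>\<^sub>M count_space Y \<Otimes>\<^sub>M count_space Y"
    by (rule measurable_Pair[OF G1 G2])
  \<comment> \<open>Finiteness makes the product of the label spaces discrete, so the set of unequal
    label pairs is measurable.\<close>
  also have "count_space Y \<Otimes>\<^sub>M count_space Y = count_space (Y \<times> Y)"
    using Y by (intro pair_measure_countable) (auto intro: countable_finite)
  finally have G: "?G \<in> ?D \<Otimes>\<^sub>M r \<rightarrow>\<^sub>M count_space (Y \<times> Y)" .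
  let ?Q = "?G -` ?N \<inter> space (?D \<Otimes>\<^sub>M r)"
  have "?Q \<in> sets (?D \<Otimes>\<^sub>M r)" by (rule measurable_sets[OF G]) auto
  then have [measurable]: "(\<lambda>z. emeasure r (Pair z -` ?Q)) \<in> borel_measurable ?D"
    by (rule measurable_emeasure_Pair)
  have eq: "robust_loss \<rho> r h z = (if enn2real (emeasure r (Pair z -` ?Q)) \<le> \<rho> then 0 else 1)"
    if z: "z \<in> space ?D" for z
  proof -
    obtain x y where xy: "z = (x, y)" by (cases z)
    have "h (x + \<delta>) \<in> Y" if "\<delta> \<in> \<Delta>" for \<delta>
      using measurable_space[OF h, of "x + \<delta>"] X[of x \<delta>] that z xy sp
      by (auto simp: space_restrict_space)
    then have "Pair z -` ?Q = {\<delta> \<in> space r. h (x + \<delta>) \<noteq> y}"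
      using z xy sp by (auto simp: space_pair_measure)
    then show ?thesis
      using robust_loss_eq[OF r(1) \<rho>, of h x y] xy by (simp add: measure_def)
  qed
  show ?thesis
    by (subst measurable_cong[OF eq]) measurable
qed

lemma borel_measurable_nominal_loss:
  assumes h: "h \<in> restrict_space borel X \<rightarrow>\<^sub>M count_space Y" and Y: "finite Y"
  shows "nominal_loss h \<in> borel_measurable (data_space X Y)"
proof -
  have fstD: "fst \<in> data_space X Y \<rightarrow>\<^sub>M restrict_space borel X"
    and sndD: "snd \<in> data_space X Y \<rightarrow>\<^sub>M count_space Y"
    by (simp_all add: data_space_def)
  have "(\<lambda>z. (h (fst z), snd z)) \<in> data_space X Y \<rightarrow>\<^sub>M count_space Y \<Otimes>\<^sub>M count_space Y"
    by (rule measurable_Pair[OF measurable_compose[OF fstD h] sndD])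
  also have "count_space Y \<Otimes>\<^sub>M count_space Y = count_space (Y \<times> Y)"
    using Y by (intro pair_measure_countable) (auto intro: countable_finite)
  finally have "(\<lambda>z. (\<lambda>u. zero_one_loss (fst u) (snd u)) (h (fst z), snd z)) \<in>
      borel_measurable (data_space X Y)"
    by (rule measurable_compose) simp
  moreover have "nominal_loss h = (\<lambda>z. (\<lambda>u. zero_one_loss (fst u) (snd u)) (h (fst z), snd z))"
    by (auto simp: nominal_loss_def)
  ultimately show ?thesis by simp
qed

lemma singleton_in_data_space:
  fixes x :: "'a :: t1_space"
  assumes "x \<in> X" "y \<in> Y"
  shows "{(x, y)} \<in> sets (data_space X Y)"
proof -
  have "{x} \<in> sets (restrict_space borel X)"
    using assms by (auto simp: sets_restrict_space intro!: image_eqI[of _ _ "{x}"])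
  then have "{x} \<times> {y} \<in> sets (restrict_space borel X \<Otimes>\<^sub>M count_space Y)"
    using assms by (intro pair_measureI) auto
  then show ?thesis by (simp add: data_space_def)
qed

text \<open>The uniform distribution on \<open>2 * k\<close> points, consecutive ones being paired:
  the odd point of a pair carries sign \<open>1\<close>, the even one \<open>-1\<close>.\<close>

lemma uniform_sign_family:
  fixes f :: "nat \<Rightarrow> 'z"
  assumes k: "0 < k" and inj: "inj_on f {..<2 * k}"
    and f: "\<And>j. j < 2 * k \<Longrightarrow> {f j} \<in> sets M"
  obtains D where "sign_family D k (\<lambda>i z. indicator {f (2 * i + 1)} z - indicator {f (2 * i)} z)"
    and "sets D = sets M" and "AE z in D. z \<in> f ` {..<2 * k}"
proof -
  define U where "U = measure_pmf (pmf_of_set {..<2 * k})"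
  \<comment> \<open>The uniform law lives on all natural numbers, so indices out of range are sent
    to \<open>f 0\<close> to keep the map inside \<open>space M\<close>.\<close>
  define g where "g j = (if j < 2 * k then f j else f 0)" for j
  define D where "D = distr U M g"
  have sp: "f j \<in> space M" if "j < 2 * k" for j
    using sets.sets_into_space[OF f[OF that]] by simp
  have g: "g \<in> U \<rightarrow>\<^sub>M M" using sp k by (auto simp: U_def g_def)
  have prob: "prob_space D"
    unfolding D_def U_def by (rule measure_pmf.prob_space_distr) (use g in \<open>simp add: U_def\<close>)
  have sets: "sets D = sets M" by (simp add: D_def)
  let ?\<xi> = "\<lambda>i z. indicator {f (2 * i + 1)} z - indicator {f (2 * i)} z :: real"
  have meas: "?\<xi> i \<in> borel_measurable M" if "i < k" for i
    using f[of "2 * i + 1"] f[of "2 * i"] that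
    by (intro borel_measurable_diff borel_measurable_indicator) auto
  have ne: "{..<2 * k} \<noteq> {}" using k by (intro ex_in_conv[THEN iffD1] exI[of _ 0]) simp
  have int: "(\<integral>z. \<phi> z \<partial>D) = (\<Sum>j<2 * k. \<phi> (f j)) / real (2 * k)"
    if "\<phi> \<in> borel_measurable M" for \<phi> :: "'z \<Rightarrow> real"
  proof -
    have "(\<integral>z. \<phi> z \<partial>D) = (\<integral>j. \<phi> (g j) \<partial>U)"
      unfolding D_def by (rule integral_distr[OF g that])
    also have "\<dots> = (\<Sum>j<2 * k. \<phi> (g j)) / real (2 * k)"
      unfolding U_def by (subst integral_pmf_of_set) (use ne in auto)
    also have "(\<Sum>j<2 * k. \<phi> (g j)) = (\<Sum>j<2 * k. \<phi> (f j))"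
      by (intro sum.cong) (auto simp: g_def)
    finally show ?thesis .
  qed
  have \<xi>f: "?\<xi> i (f j) = (if j = 2 * i + 1 then 1 else 0) - (if j = 2 * i then 1 else 0)"
    if "i < k" "j < 2 * k" for i j
    using inj_on_eq_iff[OF inj, of j "2 * i + 1"] inj_on_eq_iff[OF inj, of j "2 * i"] that
    by (auto simp: indicator_def)
  have "sign_family D k ?\<xi>"
    unfolding sign_family_def
  proof (intro conjI allI impI prob)
    fix i assume i: "i < k"
    show "?\<xi> i \<in> borel_measurable D"
      using meas[OF i] measurable_cong_sets[OF sets refl] by auto
    show "\<forall>z\<in>space D. ?\<xi> i z \<in> {-1, 0, 1}" by (auto simp: indicator_def)
    have "(\<Sum>j<2 * k. ?\<xi> i (f j)) =
        (\<Sum>j<2 * k. (if j = 2 * i + 1 then 1 else 0) - (if j = 2 * i then 1 else 0))"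
      by (intro sum.cong) (use \<xi>f[OF i] in auto)
    also have "\<dots> = 0" using i by (simp add: sum_subtractf sum.delta)
    finally show "(\<integral>z. ?\<xi> i z \<partial>D) = 0" using int[OF meas[OF i]] by simp
    have "(\<Sum>j<2 * k. (?\<xi> i (f j))\<^sup>2) =
        (\<Sum>j<2 * k. (if j = 2 * i + 1 then 1 else 0) + (if j = 2 * i then 1 else 0))"
    proof (rule sum.cong[OF refl])
      fix j assume "j \<in> {..<2 * k}"
      then have "j < 2 * k" by simp
      from \<xi>f[OF i this] show "(?\<xi> i (f j))\<^sup>2 = (if j = 2 * i + 1 then 1 else 0) + (if j = 2 * i then 1 else 0)"
        by auto
    qed
    also have "\<dots> = 2" using i by (simp add: sum.distrib sum.delta)
    finally show "(\<integral>z. (?\<xi> i z)\<^sup>2 \<partial>D) = 1 / real k"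
      using int[OF borel_measurable_power[OF meas[OF i]], of 2] by simp
  qed
  moreover have "AE z in D. z \<in> f ` {..<2 * k}"
  proof -
    have "f ` {..<2 * k} = (\<Union>j<2 * k. {f j})" by auto
    also have "\<dots> \<in> sets M" using f by (intro sets.finite_UN) auto
    finally have "{z \<in> space M. z \<in> f ` {..<2 * k}} \<in> sets M" by simp
    moreover have "AE j in U. g j \<in> f ` {..<2 * k}" using k by (auto simp: g_def)
    ultimately show ?thesis unfolding D_def by (subst AE_distr_iff[OF g])
  qed
  ultimately show thesis using sets that by blast
qed

section \<open>The hypothesis class\<close>

locale perturbation =
  fixes \<Delta> :: "'a :: euclidean_space set" and r :: "'a measure"
  assumes bounded: "bounded \<Delta>" and prob: "prob_space r" and supported: "fully_supported_on r \<Delta>"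
    and abs_continuous: "lebesgue_abs_continuous r"
begin

lemma sets_r: "sets r = sets (restrict_space borel \<Delta>)"
  using supported by (simp add: fully_supported_on_def)

lemma space_r: "space r = \<Delta>"
  using sets_eq_imp_space_eq[OF sets_r] by (simp add: space_restrict_space)

lemma Int_in_sets_r: "B \<in> sets borel \<Longrightarrow> B \<inter> \<Delta> \<in> sets r"
  by (auto simp: sets_r sets_restrict_space)

text \<open>Absolute continuity enters here: \<open>r\<close> has no atoms.\<close>

lemma measure_finite_Int:
  assumes "finite F"
  shows "measure r (F \<inter> \<Delta>) = 0"
proof -
  have "F \<in> null_sets lborel" using assms by (rule finite_imp_null_set_lborel)
  then have "F \<in> null_sets (distr r borel (\<lambda>\<delta>. \<delta>))"
    using abs_continuous by (auto simp: lebesgue_abs_continuous_def absolutely_continuous_def)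
  then have F: "F \<in> sets borel" "emeasure (distr r borel (\<lambda>\<delta>. \<delta>)) F = 0" by auto
  have "(\<lambda>\<delta>. \<delta>) \<in> borel_measurable r"
    by (subst measurable_cong_sets[OF sets_r refl], rule measurable_restrict_space1) simp
  from emeasure_distr[OF this F(1)] F(2) show ?thesis by (simp add: measure_def space_r)
qed

lemma infinite_perturbations: "infinite \<Delta>"
proof
  interpret prob_space r by (rule prob)
  assume "finite \<Delta>"
  from measure_finite_Int[OF this] show False using prob_space by (simp add: space_r)
qed

text \<open>Without atoms each centre has a radius with small mass, by continuity from above. A
  Lebesgue number of the resulting cover of a compact ball makes the radius uniform.\<close>

lemma uniformly_small_balls:
  assumes c: "0 < c"
  shows "\<exists>t>0. \<forall>z. measure r (ball z t \<inter> \<Delta>) < c"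
proof -
  interpret prob_space r by (rule prob)
  have "\<exists>s>0. measure r (ball z s \<inter> \<Delta>) < c" for z
  proof -
    let ?B = "\<lambda>n. ball z (1 / real (Suc n)) \<inter> \<Delta>"
    have "(\<lambda>n. measure r (?B n)) \<longlonglongrightarrow> measure r (\<Inter>n. ?B n)"
    proof (rule finite_Lim_measure_decseq)
      show "range ?B \<subseteq> sets r" by (auto intro!: Int_in_sets_r)
      have "1 / real (Suc n) \<le> 1 / real (Suc m)" if "m \<le> n" for m n
        using that by (intro divide_left_mono) auto
      then show "decseq ?B" unfolding decseq_def by (meson Int_mono order_refl subset_ball)
    qed
    moreover have "(\<Inter>n. ?B n) = {z} \<inter> \<Delta>"
    proof -
      have "y = z" if "\<And>n. y \<in> ball z (1 / real (Suc n))" for y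
      proof (rule ccontr)
        assume "y \<noteq> z"
        then obtain n where "1 / real (Suc n) < dist z y"
          using reals_Archimedean[of "dist z y"] by (auto simp: inverse_eq_divide)
        with that[of n] show False by simp
      qed
      then show ?thesis by fastforce
    qed
    ultimately have "(\<lambda>n. measure r (?B n)) \<longlonglongrightarrow> 0" using measure_finite_Int[of "{z}"] by simp
    then have "\<forall>\<^sub>F n in sequentially. measure r (?B n) < c" using c by (rule order_tendstoD)
    then obtain n where "measure r (?B n) < c" by (auto dest: eventually_happens)
    then show ?thesis by (intro exI[of _ "1 / real (Suc n)"]) auto
  qed
  then obtain s where s: "\<And>z. 0 < s z" "\<And>z. measure r (ball z (s z) \<inter> \<Delta>) < c" by metis
  obtain R where R: "\<And>\<delta>. \<delta> \<in> \<Delta> \<Longrightarrow> norm \<delta> \<le> R" using bounded by (auto simp: bounded_iff)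
  \<comment> \<open>The compact ball exceeds the bound on the perturbations by \<open>1\<close>, so
    balls of radius at most \<open>1\<close> centred outside it miss them.\<close>
  obtain e where e: "0 < e" "\<And>x. x \<in> cball 0 (R + 1) \<Longrightarrow> \<exists>G\<in>range (\<lambda>z. ball z (s z)). ball x e \<subseteq> G"
  proof (rule Heine_Borel_lemma)
    show "cball 0 (R + 1) \<subseteq> \<Union> (range (\<lambda>z. ball z (s z)))" 
    proof
      fix y show "y \<in> \<Union> (range (\<lambda>z. ball z (s z)))" using s(1)[of y] by (intro UnionI[of "ball y (s y)"]) auto
    qed
  qed auto
  show ?thesis
  proof (intro exI[of _ "min e 1"] conjI allI)
    show "0 < min e 1" using e by simp
    fix z
    show "measure r (ball z (min e 1) \<inter> \<Delta>) < c"
    proof (cases "z \<in> cball 0 (R + 1)")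
      case True
      then obtain y where y: "ball z e \<subseteq> ball y (s y)" using e(2) by blast
      have "measure r (ball z (min e 1) \<inter> \<Delta>) \<le> measure r (ball y (s y) \<inter> \<Delta>)"
        using y by (intro finite_measure_mono Int_in_sets_r) auto
      then show ?thesis using s(2)[of y] by simp
    next
      case False
      have "ball z (min e 1) \<inter> \<Delta> = {}"
      proof (rule ccontr)
        assume "ball z (min e 1) \<inter> \<Delta> \<noteq> {}"
        then obtain \<delta> where "\<delta> \<in> \<Delta>" "dist z \<delta> < 1" by auto
        then have "norm z \<le> R + 1" using R[of \<delta>] norm_triangle_sub[of z \<delta>] by (simp add: dist_norm)
        with False show False by simp
      qed
      then show ?thesis using c by simp
    qed
  qed
qed

text \<open>Closure of \<open>X\<close> under perturbations permits walking from any point along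
  multiples of a fixed nonzero perturbation, so \<open>X\<close> is unbounded. Taking every
  \<open>q\<close>-th point gives the required spacing.\<close>

lemma separated_translates:
  fixes L :: real
  assumes X: "X \<noteq> {}" "\<And>x \<delta>. x \<in> X \<Longrightarrow> \<delta> \<in> \<Delta> \<Longrightarrow> x + \<delta> \<in> X"
  shows "\<exists>x :: nat \<Rightarrow> 'a. (\<forall>k. x k \<in> X) \<and> (\<forall>j k. j \<noteq> k \<longrightarrow> L < dist (x j) (x k))"
proof -
  obtain x0 where x0: "x0 \<in> X" using X by blast
  have "infinite (\<Delta> - {0})" using infinite_perturbations by simp
  then obtain \<delta> where \<delta>: "\<delta> \<in> \<Delta>" "\<delta> \<noteq> 0" by (metis Diff_iff ex_in_conv finite.emptyI singletonI)
  have step: "x0 + real n *\<^sub>R \<delta> \<in> X" for n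
  proof (induction n)
    case (Suc n)
    then show ?case using X(2)[OF Suc \<delta>(1)] by (simp add: algebra_simps)
  qed (use x0 in simp)
  obtain q :: nat where "L / norm \<delta> < real q" using reals_Archimedean2 by blast
  then have q: "L < real q * norm \<delta>" using \<delta> by (simp add: field_simps)
  show ?thesis
  proof (intro exI[of _ "\<lambda>k. x0 + real (k * q) *\<^sub>R \<delta>"] conjI allI impI)
    fix k show "x0 + real (k * q) *\<^sub>R \<delta> \<in> X" by (rule step)
  next
    fix j k :: nat assume jk: "j \<noteq> k"
    have "x0 + real (j * q) *\<^sub>R \<delta> - (x0 + real (k * q) *\<^sub>R \<delta>) = ((real j - real k) * real q) *\<^sub>R \<delta>"
      by (simp add: algebra_simps)
    then have "dist (x0 + real (j * q) *\<^sub>R \<delta>) (x0 + real (k * q) *\<^sub>R \<delta>) =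
        \<bar>real j - real k\<bar> * (real q * norm \<delta>)"
      by (simp only: dist_norm norm_scaleR abs_mult abs_of_nat mult.assoc)
    moreover have "1 * (real q * norm \<delta>) \<le> \<bar>real j - real k\<bar> * (real q * norm \<delta>)"
      using jk by (intro mult_right_mono) auto
    ultimately show "L < dist (x0 + real (j * q) *\<^sub>R \<delta>) (x0 + real (k * q) *\<^sub>R \<delta>)" using q by linarith
  qed
qed

end

lemma finite_separation:
  fixes A :: "'a :: metric_space set"
  assumes "finite A"
  shows "\<exists>t>0. \<forall>a\<in>A. \<forall>b\<in>A. a \<noteq> b \<longrightarrow> 2 * t \<le> dist a b"
proof -
  \<comment> \<open>The extra \<open>1\<close> makes the minimum exist when there are no two
    distinct points.\<close>
  let ?S = "insert 1 ((\<lambda>(a, b). dist a b / 2) ` {p \<in> A \<times> A. fst p \<noteq> snd p})"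
  have fin: "finite ?S" using assms by auto
  show ?thesis
  proof (intro exI[of _ "Min ?S"] conjI ballI impI)
    show "0 < Min ?S" using fin by (auto simp: Min_gr_iff)
    fix a b assume "a \<in> A" "b \<in> A" "a \<noteq> b"
    then have "dist a b / 2 \<in> ?S" by force
    then have "Min ?S \<le> dist a b / 2" using fin by (rule Min_le[rotated])
    then show "2 * Min ?S \<le> dist a b" by simp
  qed
qed

text \<open>The points \<open>x (2 * i)\<close> and \<open>x (2 * i + 1)\<close> form the \<open>i\<close>-th pair, and a hypothesis is indexed by the
  set \<open>b\<close> of pairs in which it chooses the odd point. The offset \<open>d b\<close>, distinct for every \<open>b\<close>, keeps the
  balls of different hypotheses apart even around a common point. The point \<open>x (2 * m)\<close> is a spare,
  away from all balls.\<close>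

locale hard_class = perturbation \<Delta> r
  for \<Delta> :: "'a :: euclidean_space set" and r :: "'a measure" +
  fixes X :: "'a set" and Y :: "'y set" and y\<^sub>0 y\<^sub>1 :: 'y and \<rho>\<^sub>o R t :: real
    and m :: nat and x :: "nat \<Rightarrow> 'a" and d :: "nat set \<Rightarrow> 'a"
  assumes X: "\<And>x \<delta>. x \<in> X \<Longrightarrow> \<delta> \<in> \<Delta> \<Longrightarrow> x + \<delta> \<in> X"
    and Y: "finite Y" "y\<^sub>0 \<in> Y" "y\<^sub>1 \<in> Y" "y\<^sub>0 \<noteq> y\<^sub>1"
    and \<rho>\<^sub>o: "0 < \<rho>\<^sub>o" "\<rho>\<^sub>o < 1/2" and m: "0 < m"
    and R: "\<And>\<delta>. \<delta> \<in> \<Delta> \<Longrightarrow> norm \<delta> \<le> R"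
    and x: "\<And>k. x k \<in> X" "\<And>j k. j \<noteq> k \<Longrightarrow> 2 * R + 2 < dist (x j) (x k)"
    and d: "\<And>b. b \<in> Pow {..<m} \<Longrightarrow> d b \<in> \<Delta>"
    and d_separated: "\<And>b b'. b \<in> Pow {..<m} \<Longrightarrow> b' \<in> Pow {..<m} \<Longrightarrow> b \<noteq> b' \<Longrightarrow> 2 * t \<le> dist (d b) (d b')"
    and t: "0 < t" "t \<le> 1" "\<And>z. measure r (ball z t \<inter> \<Delta>) < \<rho>\<^sub>o / real m"
begin

section \<open>Geometry of the regions and the robust losses of the hypotheses\<close>

definition site :: "nat set \<Rightarrow> nat \<Rightarrow> nat" where
  "site b i = 2 * i + (if i \<in> b then 1 else 0)"

definition region :: "nat set \<Rightarrow> 'a set" where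
  "region b = (\<Union>i<m. ball (x (site b i) + d b) t)"

definition hyp :: "nat set \<Rightarrow> 'a \<Rightarrow> 'y" where
  "hyp b z = (if z \<in> region b then y\<^sub>1 else y\<^sub>0)"

definition cls :: "('a \<Rightarrow> 'y) set" where
  "cls = hyp ` Pow {..<m}"

lemma R_nonneg: "0 \<le> R"
  using R[OF d[of "{}"]] norm_ge_zero[of "d {}"] by (simp del: norm_ge_zero)

lemma inj_x: "inj x"
proof (rule injI)
  fix j k assume "x j = x k"
  then show "j = k" using x(2)[of j k] R_nonneg by (cases "j = k") auto
qed

lemma cls_finite: "finite cls" "cls \<noteq> {}"
  by (auto simp: cls_def)

lemma card_cls: "card cls \<le> 2 ^ m"
  unfolding cls_def using card_image_le[of "Pow {..<m}" hyp] by (simp add: card_Pow)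

lemma hyp_measurable: "hyp b \<in> restrict_space borel X \<rightarrow>\<^sub>M count_space Y"
proof -
  have "region b \<in> sets borel" unfolding region_def by (intro borel_open) auto
  then have "hyp b \<in> borel \<rightarrow>\<^sub>M count_space Y"
    unfolding hyp_def using Y by (intro measurable_If_set) auto
  then show ?thesis by (rule measurable_restrict_space1)
qed

lemma cls_hypothesis_class: "hypothesis_class X Y cls"
  using cls_finite hyp_measurable by (auto simp: hypothesis_class_def cls_def)

text \<open>Balls around a common site are kept apart by the separated offsets, balls around
  different sites by the spacing of the points: two offsets of norm at most \<open>R\<close> and a
  gap below \<open>2 * t \<le> 2\<close> cannot bridge \<open>2 * R + 2\<close>.\<close>

lemma region_disjoint:
  assumes b: "b \<in> Pow {..<m}" "b' \<in> Pow {..<m}" and z: "z \<in> region b" "z \<in> region b'"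
  shows "b = b'"
proof (rule ccontr)
  assume ne: "b \<noteq> b'"
  obtain i i' where i: "dist (x (site b i) + d b) z < t" "dist (x (site b' i') + d b') z < t"
    using z by (auto simp: region_def)
  let ?p = "x (site b i)" and ?p' = "x (site b' i')"
  have near: "dist (?p + d b) (?p' + d b') < 2 * t"
    using i dist_triangle2[of "?p + d b" "?p' + d b'" z] by linarith
  show False
  proof (cases "site b i = site b' i'")
    case True
    then show False using near d_separated[OF b ne] by simp
  next
    case False
    have "dist ?p ?p' \<le> dist (?p + d b) (?p' + d b') + norm (d b) + norm (d b')"
    proof -
      have "?p - ?p' = (?p + d b - (?p' + d b')) - d b + d b'" by simp
      then have "norm (?p - ?p') \<le> norm (?p + d b - (?p' + d b')) + norm (d b) + norm (d b')"
        using norm_triangle_ineq[of "?p + d b - (?p' + d b') - d b" "d b'"]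
          norm_triangle_ineq4[of "?p + d b - (?p' + d b')" "d b"] by simp
      then show ?thesis by (simp add: dist_norm)
    qed
    then show False using near t R[OF d[OF b(1)]] R[OF d[OF b(2)]] x(2)[OF False] by linarith
  qed
qed

lemma region_near_sites:
  assumes b: "b \<in> Pow {..<m}" and i: "i < m" and y: "y \<in> ball (x (site b i) + d b) t"
  shows "dist (x (site b i)) y < R + 1"
proof -
  have "dist (x (site b i)) y \<le> dist (x (site b i)) (x (site b i) + d b) + dist (x (site b i) + d b) y"
    by (rule dist_triangle)
  also have "\<dots> < R + 1" using R[OF d[OF b]] y t by (simp add: dist_norm)
  finally show ?thesis .
qed

text \<open>At this point all hypotheses agree, so labelling it by a fair coin gives the nominal
  lower bound.\<close>

lemma far_point_not_in_region:
  assumes b: "b \<in> Pow {..<m}"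
  shows "x (2 * m) \<notin> region b"
proof
  assume "x (2 * m) \<in> region b"
  then obtain i where i: "i < m" "x (2 * m) \<in> ball (x (site b i) + d b) t" by (auto simp: region_def)
  have "site b i \<noteq> 2 * m" using i by (auto simp: site_def)
  from x(2)[OF this] region_near_sites[OF b i] R_nonneg show False by linarith
qed

lemma translate_region_in_sets: "{\<delta> \<in> \<Delta>. z + \<delta> \<in> region b} \<in> sets r"
proof -
  have "open ((\<lambda>\<delta>. z + \<delta>) -` region b)"
    unfolding region_def by (intro open_vimage continuous_intros) auto
  then have "(\<lambda>\<delta>. z + \<delta>) -` region b \<inter> \<Delta> \<in> sets r" by (intro Int_in_sets_r borel_open)
  moreover have "{\<delta> \<in> \<Delta>. z + \<delta> \<in> region b} = (\<lambda>\<delta>. z + \<delta>) -` region b \<inter> \<Delta>" by auto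
  ultimately show ?thesis by simp
qed

text \<open>The bound is uniform in \<open>z\<close>, not restricted to the chosen points: a
  translated region still consists of \<open>m\<close> balls of radius \<open>t\<close>, each
  lighter than \<open>\<rho>\<^sub>o / m\<close>.\<close>

lemma measure_translate_region: "measure r {\<delta> \<in> \<Delta>. z + \<delta> \<in> region b} < \<rho>\<^sub>o"
proof -
  interpret prob_space r by (rule prob)
  let ?B = "\<lambda>i. ball (x (site b i) + d b - z) t \<inter> \<Delta>"
  have "{\<delta> \<in> \<Delta>. z + \<delta> \<in> region b} = (\<Union>i<m. ?B i)"
    by (auto simp: region_def dist_norm algebra_simps)
  also have "measure r \<dots> \<le> (\<Sum>i<m. measure r (?B i))"
    by (rule finite_measure_subadditive_finite) (auto intro!: Int_in_sets_r)
  also have "\<dots> < (\<Sum>i<m. \<rho>\<^sub>o / real m)" by (rule sum_strict_mono) (use m t in auto)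
  also have "\<dots> = \<rho>\<^sub>o" using m by simp
  finally show ?thesis .
qed

text \<open>For label \<open>y\<^sub>0\<close> the errors have mass below
  \<open>\<rho>\<^sub>o\<close>, for \<open>y\<^sub>1\<close> above
  \<open>1 - \<rho>\<^sub>o\<close>, and for any other label mass one, so both endpoints of the
  range of levels are covered.\<close>

lemma robust_loss_high_level:
  assumes \<rho>: "\<rho>\<^sub>o \<le> \<rho>" "\<rho> \<le> 1 - \<rho>\<^sub>o"
  shows "robust_loss \<rho> r (hyp b) (z, y) = (if y = y\<^sub>0 then 0 else 1)"
proof -
  interpret prob_space r by (rule prob)
  have eq: "robust_loss \<rho> r (hyp b) (z, y) =
      (if measure r {\<delta> \<in> \<Delta>. hyp b (z + \<delta>) \<noteq> y} \<le> \<rho> then 0 else 1)"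
    using robust_loss_eq[OF prob, of \<rho> "hyp b" z y] \<rho> \<rho>\<^sub>o by (simp add: space_r)
  let ?T = "{\<delta> \<in> \<Delta>. z + \<delta> \<in> region b}"
  note T = measure_translate_region[of z b] translate_region_in_sets[of z b]
  consider "y = y\<^sub>0" | "y = y\<^sub>1" | "y \<noteq> y\<^sub>0" "y \<noteq> y\<^sub>1" by blast
  then show ?thesis
  proof cases
    case 1
    then have "{\<delta> \<in> \<Delta>. hyp b (z + \<delta>) \<noteq> y} = ?T" using Y by (auto simp: hyp_def)
    then show ?thesis using T \<rho> 1 eq by simp
  next
    case 2
    then have "{\<delta> \<in> \<Delta>. hyp b (z + \<delta>) \<noteq> y} = space r - ?T" using Y by (auto simp: hyp_def space_r)
    then show ?thesis using T \<rho> 2 Y eq prob_compl[OF T(2)] by simp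
  next
    case 3
    then have "{\<delta> \<in> \<Delta>. hyp b (z + \<delta>) \<noteq> y} = space r" by (auto simp: hyp_def space_r)
    then show ?thesis using \<rho> \<rho>\<^sub>o 3 eq prob_space by simp
  qed
qed

text \<open>The parity condition says that point \<open>j\<close> is chosen by \<open>b\<close>.
  Then a ball around \<open>d b\<close> is harmful and has positive mass by full support; otherwise
  the spacing of the points keeps every perturbation of \<open>x j\<close> out of the
  region.\<close>

lemma robust_loss_zero_at_site:
  assumes b: "b \<in> Pow {..<m}" and j: "j < 2 * m"
  shows "robust_loss 0 r (hyp b) (x j, y\<^sub>0) = (if odd j \<longleftrightarrow> j div 2 \<in> b then 1 else 0)"
proof -
  let ?T = "{\<delta> \<in> \<Delta>. x j + \<delta> \<in> region b}"
  have "{\<delta> \<in> \<Delta>. hyp b (x j + \<delta>) \<noteq> y\<^sub>0} = ?T" using Y by (auto simp: hyp_def)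
  then have eq: "robust_loss 0 r (hyp b) (x j, y\<^sub>0) = (if measure r ?T \<le> 0 then 0 else 1)"
    using robust_loss_eq[OF prob, of 0 "hyp b" "x j" y\<^sub>0] by (simp add: space_r)
  show ?thesis
  proof (cases "odd j \<longleftrightarrow> j div 2 \<in> b")
    case True
    then have j': "site b (j div 2) = j" by (auto simp: site_def elim: evenE oddE)
    have sub: "ball (d b) t \<inter> \<Delta> \<subseteq> ?T"
    proof
      fix \<delta> assume \<delta>: "\<delta> \<in> ball (d b) t \<inter> \<Delta>"
      then have "x j + \<delta> \<in> ball (x (site b (j div 2)) + d b) t" by (simp add: j' dist_norm)
      moreover have "j div 2 < m" using j by simp
      ultimately show "\<delta> \<in> ?T" using \<delta> unfolding region_def by blast
    qed
    interpret prob_space r by (rule prob)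
    have "0 < measure r (ball (d b) t \<inter> \<Delta>)"
      using supported d[OF b] t(1) unfolding fully_supported_on_def
      by (metis centre_in_ball disjoint_iff open_ball)
    also have "\<dots> \<le> measure r ?T" using sub translate_region_in_sets by (rule finite_measure_mono)
    finally show ?thesis using True eq by simp
  next
    case False
    have "?T = {}"
    proof (rule ccontr)
      assume "?T \<noteq> {}"
      then obtain \<delta> i where \<delta>: "\<delta> \<in> \<Delta>" and i: "i < m" "x j + \<delta> \<in> ball (x (site b i) + d b) t"
        by (auto simp: region_def)
      have "site b i \<noteq> j" using False by (auto simp: site_def split: if_splits)
      from x(2)[OF this] region_near_sites[OF b i] R[OF \<delta>] dist_triangle[of "x (site b i)" "x j" "x j + \<delta>"]
      show False by (simp add: dist_norm)
    qed
    then have "measure r ?T = 0" by (simp only: measure_empty)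
    then show ?thesis using False eq by simp
  qed
qed

end

section \<open>Sample complexities of the class\<close>

context hard_class
begin

lemma robust_loss_measurable:
  assumes "0 \<le> \<rho>" "\<rho> < 1" "h \<in> cls"
  shows "robust_loss \<rho> r h \<in> borel_measurable (data_space X Y)"
  using assms hyp_measurable
  by (intro borel_measurable_robust_loss[OF prob sets_r X _ Y(1)]) (auto simp: cls_def)

text \<open>Common to the high levels and the nominal loss: a label coin at the spare point gives
  the lower bound, and Chebyshev's inequality around the loss of the constant
  \<open>y\<^sub>0\<close> the upper one.\<close>

lemma inverse_square_complexity:
  fixes L :: "('a \<Rightarrow> 'y) \<Rightarrow> 'a \<times> 'y \<Rightarrow> real"
  defines "g \<equiv> nominal_loss (\<lambda>_. y\<^sub>0)"
  assumes Lm: "\<And>h. h \<in> cls \<Longrightarrow> L h \<in> borel_measurable (data_space X Y)"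
    and sq: "\<And>z. (\<Sum>h\<in>cls. (L h z - g z)\<^sup>2) \<le> 1"
    and far: "\<And>h. h \<in> cls \<Longrightarrow> L h (x (2 * m), y\<^sub>0) = 0" "\<And>h. h \<in> cls \<Longrightarrow> L h (x (2 * m), y\<^sub>1) = 1"
    and \<eta>: "0 < \<eta>" "\<eta> < 1/4" and \<epsilon>: "0 < \<epsilon>" "\<epsilon> \<le> 1/200"
  shows "within_factors (1/2000) (9 / \<eta>) (sample_complexity (data_space X Y) L cls \<eta> \<epsilon>) (1 / \<epsilon>\<^sup>2)"
proof (rule sample_complexity_within_factors)
  fix N :: nat assume N: "0 < N" "real N < 1/2000 * (1 / \<epsilon>\<^sup>2)"
  define f where "f j = (x (2 * m), if j = 0 then y\<^sub>0 else y\<^sub>1)" for j :: nat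
  obtain D where F: "sign_family D 1 (\<lambda>i z. indicator {f (2 * i + 1)} z - indicator {f (2 * i)} z)"
    and D: "sets D = sets (data_space X Y)" "AE z in D. z \<in> f ` {..<2 * 1}"
  proof (rule uniform_sign_family)
    show "inj_on f {..<2 * 1}" using Y by (auto simp: inj_on_def f_def split: if_splits)
    show "{f j} \<in> sets (data_space X Y)" for j
      unfolding f_def using x(1) Y by (intro singleton_in_data_space) auto
  qed auto
  let ?\<xi> = "\<lambda>z. indicator {f 1} z - indicator {f 0} z :: real"
  show "\<not> samples_suffice (data_space X Y) L cls \<eta> \<epsilon> N"
  proof (rule not_samples_suffice_coin[OF _ D(1) cls_finite(2) _ Lm \<eta>(2) \<epsilon>(1) N(1)])
    show "sign_family D 1 (\<lambda>_. ?\<xi>)" using F by (simp add: sign_family_def)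
    have "f 0 \<noteq> f 1" using Y by (simp add: f_def)
    moreover have "L h (f 0) = 0" "L h (f 1) = 1" if "h \<in> cls" for h
      using far that by (simp_all add: f_def)
    ultimately have "\<forall>h\<in>cls. L h z = 1/2 + ?\<xi> z / 2" if "z \<in> f ` {..<2 * 1}" for z
      using that by (auto simp: indicator_def less_2_cases_iff)
    then show "AE z in D. \<forall>h\<in>cls. L h z = 1/2 + ?\<xi> z / 2"
      using D(2) by (auto elim!: eventually_mono)
    have "1/2000 * (1 / \<epsilon>\<^sup>2) \<le> 1 / (40 * \<epsilon>\<^sup>2)" using \<epsilon> by (simp add: field_simps)
    then show "real N \<le> 1 / (40 * \<epsilon>\<^sup>2)" using N by simp
  qed
next
  \<comment> \<open>Rounding up costs at most
    \<open>1 \<le> 1 / (\<eta> * \<epsilon>\<^sup>2)\<close>, which turns the \<open>8\<close> of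
    the Chebyshev bound into \<open>9\<close>.\<close>
  define N where "N = nat \<lceil>8 / (\<eta> * \<epsilon>\<^sup>2)\<rceil>"
  have pos: "0 < 8 / (\<eta> * \<epsilon>\<^sup>2)" using \<eta> \<epsilon> by simp
  then have N: "0 < N" "8 / (\<eta> * \<epsilon>\<^sup>2) \<le> real N" "real N \<le> 8 / (\<eta> * \<epsilon>\<^sup>2) + 1"
    unfolding N_def by linarith+
  show "0 < N" by (rule N)
  show "samples_suffice (data_space X Y) L cls \<eta> \<epsilon> N"
  proof (rule samples_suffice_chebyshev[OF cls_finite Lm])
    show "g \<in> borel_measurable (data_space X Y)"
      unfolding g_def using Y by (intro borel_measurable_nominal_loss) auto
    show "\<bar>g z\<bar> \<le> 1" for z by (auto simp: g_def nominal_loss_def zero_one_loss_def split: prod.split)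
  qed (use sq \<epsilon> \<eta> N in auto)
  have "\<epsilon>\<^sup>2 \<le> 1\<^sup>2" using \<epsilon> by (intro power_mono) auto
  then have "\<eta> * \<epsilon>\<^sup>2 \<le> 1" using \<eta> by (intro mult_le_one) auto
  then have "1 \<le> 1 / (\<eta> * \<epsilon>\<^sup>2)" using \<eta> \<epsilon> by (simp add: field_simps)
  then have "real N \<le> 9 / (\<eta> * \<epsilon>\<^sup>2)" using N(3) by simp
  then show "real N \<le> 9 / \<eta> * (1 / \<epsilon>\<^sup>2)" by simp
qed

lemma high_level_complexity:
  assumes \<rho>: "\<rho>\<^sub>o \<le> \<rho>" "\<rho> \<le> 1 - \<rho>\<^sub>o" and \<eta>: "0 < \<eta>" "\<eta> < 1/4" and \<epsilon>: "0 < \<epsilon>" "\<epsilon> \<le> 1/200"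
  shows "within_factors (1/2000) (9 / \<eta>)
    (sample_complexity (data_space X Y) (robust_loss \<rho> r) cls \<eta> \<epsilon>) (1 / \<epsilon>\<^sup>2)"
proof (rule inverse_square_complexity[OF _ _ _ _ \<eta> \<epsilon>])
  have eq: "robust_loss \<rho> r h (z, y) = (if y = y\<^sub>0 then 0 else 1)" if "h \<in> cls" for h z y
    using that robust_loss_high_level[OF \<rho>] by (auto simp: cls_def)
  show "robust_loss \<rho> r h \<in> borel_measurable (data_space X Y)" if "h \<in> cls" for h
    using \<rho> \<rho>\<^sub>o that by (intro robust_loss_measurable) auto
  show "(\<Sum>h\<in>cls. (robust_loss \<rho> r h z - nominal_loss (\<lambda>_. y\<^sub>0) z)\<^sup>2) \<le> 1" for z
    by (cases z) (simp add: eq nominal_loss_def zero_one_loss_def)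
qed (use \<rho> robust_loss_high_level Y in \<open>auto simp: cls_def\<close>)

text \<open>A hypothesis differs from the constant \<open>y\<^sub>0\<close> only on its own region;
  by disjointness at most one difference is nonzero at any sample.\<close>

lemma nominal_complexity:
  assumes \<eta>: "0 < \<eta>" "\<eta> < 1/4" and \<epsilon>: "0 < \<epsilon>" "\<epsilon> \<le> 1/200"
  shows "within_factors (1/2000) (9 / \<eta>)
    (sample_complexity (data_space X Y) nominal_loss cls \<eta> \<epsilon>) (1 / \<epsilon>\<^sup>2)"
proof (rule inverse_square_complexity[OF _ _ _ _ \<eta> \<epsilon>])
  show "nominal_loss h \<in> borel_measurable (data_space X Y)" if "h \<in> cls" for h
    using that hyp_measurable Y by (intro borel_measurable_nominal_loss) (auto simp: cls_def)
  show "nominal_loss h (x (2 * m), y\<^sub>0) = 0" "nominal_loss h (x (2 * m), y\<^sub>1) = 1" if "h \<in> cls" for h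
    using that far_point_not_in_region Y by (auto simp: cls_def hyp_def nominal_loss_def zero_one_loss_def)
  fix z :: "'a \<times> 'y"
  let ?f = "\<lambda>h. nominal_loss h z - nominal_loss (\<lambda>_. y\<^sub>0) z"
  show "(\<Sum>h\<in>cls. (?f h)\<^sup>2) \<le> 1"
  proof (rule finite_sq_sum_le_1[OF cls_finite(1)])
    show "\<bar>?f h\<bar> \<le> 1" for h
      by (cases z) (auto simp: nominal_loss_def zero_one_loss_def)
    have "fst z \<in> region b" if "?f (hyp b) \<noteq> 0" for b
      using that by (cases z) (auto simp: nominal_loss_def hyp_def split: if_splits)
    then show "h = h'" if "h \<in> cls" "h' \<in> cls" "?f h \<noteq> 0" "?f h' \<noteq> 0" for h h'
      using that region_disjoint unfolding cls_def by blast
  qed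
qed

text \<open>At \<open>x j\<close> only the pair \<open>j div 2\<close> contributes, and the product
  of its two signs is \<open>1\<close> exactly when \<open>j\<close> is the chosen point. This
  identifies the losses with a cube.\<close>

lemma zero_level_sign_representation:
  assumes k: "k \<le> m" and b: "b \<in> Pow {..<m}" and z: "z \<in> (\<lambda>j. (x j, y\<^sub>0)) ` {..<2 * k}"
  shows "robust_loss 0 r (hyp b) z = 1/2 + (\<Sum>i<k. (if i \<in> b then 1 else - 1) *
    (indicator {(x (2 * i + 1), y\<^sub>0)} z - indicator {(x (2 * i), y\<^sub>0)} z)) / 2"
proof -
  obtain j where j: "j < 2 * k" "z = (x j, y\<^sub>0)" using z by auto
  have ind: "indicator {(x l, y\<^sub>0)} z = (if l = j then 1 else 0 :: real)" for l
    using inj_eq[OF inj_x, of l j] j by (auto simp: indicator_def)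
  have "(\<Sum>i<k. (if i \<in> b then 1 else - 1) *
      (indicator {(x (2 * i + 1), y\<^sub>0)} z - indicator {(x (2 * i), y\<^sub>0)} z)) =
      (\<Sum>i<k. if i = j div 2 then (if i \<in> b then 1 else - 1) * (if odd j then 1 else - 1) else 0 :: real)"
  proof (rule sum.cong[OF refl])
    fix i
    have "2 * i + 1 = j \<longleftrightarrow> odd j \<and> i = j div 2" "2 * i = j \<longleftrightarrow> even j \<and> i = j div 2"
      by (auto elim: evenE oddE)
    then show "(if i \<in> b then 1 else - 1) * (indicator {(x (2 * i + 1), y\<^sub>0)} z - indicator {(x (2 * i), y\<^sub>0)} z) =
        (if i = j div 2 then (if i \<in> b then 1 else - 1) * (if odd j then 1 else - 1) else 0 :: real)"
      unfolding ind by auto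
  qed
  also have "\<dots> = (if j div 2 \<in> b then 1 else - 1) * (if odd j then 1 else - 1)"
    using j by (simp add: sum.delta)
  finally show ?thesis
    using robust_loss_zero_at_site[OF b, of j] j k by auto
qed

text \<open>Here \<open>l\<close> plays the role of the logarithm and \<open>m\<close> of its
  rounding; \<open>m \<le> 2 * l\<close> lets the bounds in \<open>m\<close> be stated in
  \<open>l\<close>.\<close>

lemma zero_level_complexity:
  fixes l :: real
  assumes l: "1 \<le> l" "l \<le> real m" "real m \<le> 2 * l"
    and \<eta>: "0 < \<eta>" "\<eta> < 1/4" and \<epsilon>: "0 < \<epsilon>" "\<epsilon> \<le> 1/200"
  shows "within_factors (1/2000) (9 / \<eta>)
    (sample_complexity (data_space X Y) (robust_loss 0 r) cls \<eta> \<epsilon>) (l / \<epsilon>\<^sup>2)"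
proof (rule sample_complexity_within_factors)
  fix N :: nat assume N: "0 < N" "real N < 1/2000 * (l / \<epsilon>\<^sup>2)"
  show "\<not> samples_suffice (data_space X Y) (robust_loss 0 r) cls \<eta> \<epsilon> N"
  proof (rule not_samples_suffice_cube[OF _ cls_def m _ \<eta>(2) \<epsilon> N(1)])
    fix k :: nat assume k: "0 < k" "k \<le> m"
    let ?f = "\<lambda>j. (x j, y\<^sub>0)"
    let ?\<xi> = "\<lambda>i z. indicator {?f (2 * i + 1)} z - indicator {?f (2 * i)} z :: real"
    obtain D where F: "sign_family D k ?\<xi>"
      and D: "sets D = sets (data_space X Y)" "AE z in D. z \<in> ?f ` {..<2 * k}"
    proof (rule uniform_sign_family[OF k(1), of ?f])
      show "inj_on ?f {..<2 * k}" using inj_x by (auto simp: inj_on_def)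
      show "{?f j} \<in> sets (data_space X Y)" for j
        using x(1) Y by (intro singleton_in_data_space) auto
    qed
    have "AE z in D. \<forall>b\<in>Pow {..<m}. robust_loss 0 r (hyp b) z =
        1/2 + (\<Sum>i<k. (if i \<in> b then 1 else - 1) * ?\<xi> i z) / 2"
      using D(2) by (rule eventually_mono) (use zero_level_sign_representation[OF k(2)] in blast)
    with F D show "\<exists>D \<xi>. sign_family D k \<xi> \<and> sets D = sets (data_space X Y) \<and>
        (AE z in D. \<forall>b\<in>Pow {..<m}. robust_loss 0 r (hyp b) z =
          1/2 + (\<Sum>i<k. (if i \<in> b then 1 else - 1) * \<xi> i z) / 2)"
      by blast
  next
    show "robust_loss 0 r h \<in> borel_measurable (data_space X Y)" if "h \<in> cls" for h
      using that by (intro robust_loss_measurable) auto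
    have "1/2000 * (l / \<epsilon>\<^sup>2) \<le> 1/2000 * (real m / \<epsilon>\<^sup>2)"
      using l \<epsilon> by (intro mult_left_mono divide_right_mono) auto
    then show "real N \<le> real m / (2000 * \<epsilon>\<^sup>2)" using N by simp
  qed
next
  \<comment> \<open>This dominates the Hoeffding requirement for at most \<open>2 ^ m\<close>
    hypotheses, using \<open>ln 2 \<le> 1\<close> and
    \<open>ln (1 / \<eta>) \<le> 1 / \<eta>\<close>.\<close>
  define u where "u = (real m + 1 + 1 / \<eta>) / (2 * \<epsilon>\<^sup>2)"
  define N where "N = nat \<lceil>u\<rceil>"
  have "0 < u" unfolding u_def using \<eta> \<epsilon> by (intro divide_pos_pos add_nonneg_pos) auto
  then have N: "0 < N" "u \<le> real N" "real N \<le> u + 1" unfolding N_def by linarith+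
  show "0 < N" by (rule N)
  show "samples_suffice (data_space X Y) (robust_loss 0 r) cls \<eta> \<epsilon> N"
  proof (rule samples_suffice_hoeffding[OF cls_finite])
    show "robust_loss 0 r h \<in> borel_measurable (data_space X Y)" if "h \<in> cls" for h
      using that by (intro robust_loss_measurable) auto
    show "robust_loss 0 r h z \<in> {0..1}" for h z
      using robust_loss_eq[OF prob, of 0 h "fst z" "snd z"] by simp
    have c: "0 < real (card cls)" using cls_finite by (simp add: card_gt_0_iff)
    have "real (card cls) \<le> 2 ^ m" using card_cls by (metis of_nat_le_iff of_nat_numeral of_nat_power)
    then have "2 * real (card cls) / \<eta> \<le> 2 * 2 ^ m / \<eta>" using \<eta> by (intro divide_right_mono mult_left_mono) auto
    then have "ln (2 * real (card cls) / \<eta>) \<le> ln (2 ^ Suc m * (1 / \<eta>))"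
      using c \<eta> by (subst ln_le_cancel_iff) auto
    also have "\<dots> = real (Suc m) * ln 2 + ln (1 / \<eta>)"
      using \<eta> by (subst ln_mult) (auto simp: ln_realpow simp del: power_Suc)
    also have "\<dots> \<le> real (Suc m) * 1 + 1 / \<eta>"
    proof (intro add_mono mult_left_mono)
      show "ln 2 \<le> (1 :: real)" using ln_le_minus_one[of 2] by simp
      show "ln (1 / \<eta>) \<le> 1 / \<eta>" using ln_le_minus_one[of "1 / \<eta>"] \<eta> by simp
    qed auto
    also have "\<dots> = 2 * u * \<epsilon>\<^sup>2" using \<epsilon> by (simp add: u_def)
    also have "\<dots> \<le> 2 * real N * \<epsilon>\<^sup>2" using N by (intro mult_right_mono) auto
    finally show "ln (2 * real (card cls) / \<eta>) \<le> 2 * real N * \<epsilon>\<^sup>2" .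
  qed (use \<epsilon> \<eta> N in auto)
  have "\<epsilon>\<^sup>2 \<le> 1\<^sup>2" using \<epsilon> by (intro power_mono) auto
  then have \<epsilon>2: "\<epsilon>\<^sup>2 \<le> 1" "0 < \<epsilon>\<^sup>2" using \<epsilon> by auto
  have e4: "4 \<le> 1 / \<eta>" using \<eta> by (simp add: field_simps)
  have le: "1 / \<eta> \<le> l * (1 / \<eta>)" using mult_right_mono[OF l(1), of "1 / \<eta>"] \<eta> by simp
  have "l * 4 \<le> l * (1 / \<eta>)" using e4 l by (intro mult_left_mono) auto
  \<comment> \<open>A generous bound; \<open>18\<close> yields after division by \<open>2\<close>
    the same constant \<open>9 / \<eta>\<close> as at the other levels.\<close>
  have "real m + 1 + 1 / \<eta> + 2 * \<epsilon>\<^sup>2 \<le> 18 * (l * (1 / \<eta>))"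
    using l \<epsilon>2 e4 le \<open>l * 4 \<le> l * (1 / \<eta>)\<close> by simp
  then have "(real m + 1 + 1 / \<eta> + 2 * \<epsilon>\<^sup>2) / (2 * \<epsilon>\<^sup>2) \<le> 18 * (l * (1 / \<eta>)) / (2 * \<epsilon>\<^sup>2)"
    by (intro divide_right_mono) auto
  moreover have "u + 1 = (real m + 1 + 1 / \<eta> + 2 * \<epsilon>\<^sup>2) / (2 * \<epsilon>\<^sup>2)"
    using \<epsilon>2 unfolding u_def by (simp add: add_divide_distrib)
  moreover have "18 * (l * (1 / \<eta>)) / (2 * \<epsilon>\<^sup>2) = 9 / \<eta> * (l / \<epsilon>\<^sup>2)" by simp
  ultimately show "real N \<le> 9 / \<eta> * (l / \<epsilon>\<^sup>2)" using N(3) by linarith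
qed

end

section \<open>Existence of the class and the combined bounds\<close>

lemma (in perturbation) hard_class_exists:
  assumes X: "X \<noteq> {}" "\<And>x \<delta>. x \<in> X \<Longrightarrow> \<delta> \<in> \<Delta> \<Longrightarrow> x + \<delta> \<in> X"
    and Y: "finite Y" "y\<^sub>0 \<in> Y" "y\<^sub>1 \<in> Y" "y\<^sub>0 \<noteq> y\<^sub>1"
    and \<rho>\<^sub>o: "0 < \<rho>\<^sub>o" "\<rho>\<^sub>o < 1/2" and m: "0 < m"
  shows "\<exists>R t x d. hard_class \<Delta> r X Y y\<^sub>0 y\<^sub>1 \<rho>\<^sub>o R t m x d"
proof -
  obtain R where R: "\<And>\<delta>. \<delta> \<in> \<Delta> \<Longrightarrow> norm \<delta> \<le> R" using bounded by (auto simp: bounded_iff)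
  obtain x :: "nat \<Rightarrow> 'a" where x: "\<forall>k. x k \<in> X" "\<forall>j k. j \<noteq> k \<longrightarrow> 2 * R + 2 < dist (x j) (x k)"
    using separated_translates[OF X, of "2 * R + 2"] by blast
  \<comment> \<open>One offset per hypothesis is needed; an infinite set of perturbations provides
    \<open>2 ^ m\<close> distinct ones.\<close>
  obtain T where T: "T \<subseteq> \<Delta>" "finite T" "card T = card (Pow {..<m})"
    using infinite_arbitrarily_large[OF infinite_perturbations, of "card (Pow {..<m})"] by auto
  obtain d where d: "bij_betw d (Pow {..<m}) T"
    using finite_same_card_bij[OF _ T(2) T(3)[symmetric]] by auto
  obtain t1 where t1: "0 < t1" "\<forall>a\<in>T. \<forall>b\<in>T. a \<noteq> b \<longrightarrow> 2 * t1 \<le> dist a b"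
    using finite_separation[OF T(2)] by blast
  have c: "0 < \<rho>\<^sub>o / real m" using \<rho>\<^sub>o m by simp
  obtain t2 where t2: "0 < t2" "\<forall>z. measure r (ball z t2 \<inter> \<Delta>) < \<rho>\<^sub>o / real m"
    using uniformly_small_balls[OF c] by blast
  interpret prob_space r by (rule prob)
  \<comment> \<open>The radius meets three demands: at most \<open>1\<close> for the spacing of
    sites, \<open>t1\<close> for separating the offsets, \<open>t2\<close> for small mass.\<close>
  define t where "t = min 1 (min t1 t2)"
  have "hard_class \<Delta> r X Y y\<^sub>0 y\<^sub>1 \<rho>\<^sub>o R t m x d"
  proof unfold_locales
    fix b assume b: "b \<in> Pow {..<m}"
    then have db: "d b \<in> T" using bij_betwE[OF d] by blast
    then show "d b \<in> \<Delta>" using T by blast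
    fix b' assume b': "b' \<in> Pow {..<m}" "b \<noteq> b'"
    then have "d b' \<in> T" "d b \<noteq> d b'"
      using bij_betwE[OF d] b bij_betw_imp_inj_on[OF d] by (auto dest: inj_onD)
    then have "2 * t1 \<le> dist (d b) (d b')" using t1 db by blast
    then show "2 * t \<le> dist (d b) (d b')" by (simp add: t_def)
  next
    fix z
    have "measure r (ball z t \<inter> \<Delta>) \<le> measure r (ball z t2 \<inter> \<Delta>)"
      by (intro finite_measure_mono Int_in_sets_r) (auto simp: t_def)
    then show "measure r (ball z t \<inter> \<Delta>) < \<rho>\<^sub>o / real m" using t2(2)[rule_format, of z] by simp
  next
    show "0 < t" "t \<le> 1" using t1(1) t2(1) by (auto simp: t_def)
  qed (fact X Y \<rho>\<^sub>o m R x[rule_format])+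
  then show ?thesis by blast
qed

theorem propositionB1:
  shows "\<exists>c C \<epsilon>\<^sub>0 :: real \<Rightarrow> real.
    (\<forall>\<eta>\<in>{0<..<1/4}. 0 < c \<eta> \<and> 0 < C \<eta> \<and> 0 < \<epsilon>\<^sub>0 \<eta>) \<and>
    (\<forall>(\<Delta> :: (real ^ 'd) set) (r :: (real ^ 'd) measure) (X :: (real ^ 'd) set) (Y :: 'y set).
       bounded \<Delta> \<and> prob_space r \<and> fully_supported_on r \<Delta> \<and> lebesgue_abs_continuous r \<and>
       X \<noteq> {} \<and> (\<forall>x\<in>X. \<forall>\<delta>\<in>\<Delta>. x + \<delta> \<in> X) \<and> finite Y \<and> card Y \<ge> 2 \<longrightarrow>
       (\<forall>\<rho>\<^sub>o\<in>{0<..<1/2}. \<exists>H\<^sub>o. hypothesis_class X Y H\<^sub>o \<and>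
          (\<forall>\<eta>\<in>{0<..<1/4}. \<forall>\<epsilon>. 0 < \<epsilon> \<and> \<epsilon> \<le> \<epsilon>\<^sub>0 \<eta> \<longrightarrow>
             within_factors (c \<eta>) (C \<eta>)
               (sample_complexity (data_space X Y) (robust_loss 0 r) H\<^sub>o \<eta> \<epsilon>)
               (log 2 (1 / \<rho>\<^sub>o) / \<epsilon>\<^sup>2) \<and>
             (\<forall>\<rho>. \<rho>\<^sub>o \<le> \<rho> \<and> \<rho> \<le> 1 - \<rho>\<^sub>o \<longrightarrow>
                within_factors (c \<eta>) (C \<eta>)
                  (sample_complexity (data_space X Y) (robust_loss \<rho> r) H\<^sub>o \<eta> \<epsilon>)
                  (1 / \<epsilon>\<^sup>2)) \<and>
             within_factors (c \<eta>) (C \<eta>)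
               (sample_complexity (data_space X Y) nominal_loss H\<^sub>o \<eta> \<epsilon>)
               (1 / \<epsilon>\<^sup>2))))"
\<comment> \<open>Only the upper constant depends on the confidence.\<close>
proof (rule exI[of _ "\<lambda>_. 1/2000"], rule exI[of _ "\<lambda>\<eta>. 9 / \<eta>"], rule exI[of _ "\<lambda>_. 1/200"],
    intro conjI ballI allI impI)
  fix \<Delta> :: "(real ^ 'd) set" and r :: "(real ^ 'd) measure" and X :: "(real ^ 'd) set"
    and Y :: "'y set" and \<rho>\<^sub>o :: real
  assume A: "bounded \<Delta> \<and> prob_space r \<and> fully_supported_on r \<Delta> \<and> lebesgue_abs_continuous r \<and>
       X \<noteq> {} \<and> (\<forall>x\<in>X. \<forall>\<delta>\<in>\<Delta>. x + \<delta> \<in> X) \<and> finite Y \<and> card Y \<ge> 2"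
    and \<rho>\<^sub>o: "\<rho>\<^sub>o \<in> {0<..<1/2}"
  interpret perturbation \<Delta> r by (rule perturbation.intro) (use A in auto)
  obtain y\<^sub>0 y\<^sub>1 where y: "y\<^sub>0 \<in> Y" "y\<^sub>1 \<in> Y" "y\<^sub>0 \<noteq> y\<^sub>1"
  proof -
    have "\<not> card Y \<le> Suc 0" using A by linarith
    then show thesis using A that by (auto simp: card_le_Suc0_iff_eq)
  qed
  define l where "l = log 2 (1 / \<rho>\<^sub>o)"
  define m where "m = nat \<lceil>l\<rceil>"
  have "2 \<le> 1 / \<rho>\<^sub>o" using \<rho>\<^sub>o by (simp add: field_simps)
  \<comment> \<open>The restriction \<open>\<rho>\<^sub>o < 1/2\<close> makes the logarithm at least
    one, so that rounding it up at most doubles it.\<close>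
  then have l: "1 \<le> l" unfolding l_def using \<rho>\<^sub>o by (subst le_log_iff) auto
  then have ml: "0 < m" "l \<le> real m" "real m \<le> 2 * l" unfolding m_def by linarith+
  obtain R t x d where hc: "hard_class \<Delta> r X Y y\<^sub>0 y\<^sub>1 \<rho>\<^sub>o R t m x d"
    using hard_class_exists[OF _ _ _ y _ _ ml(1), of X \<rho>\<^sub>o] A \<rho>\<^sub>o by auto
  interpret hard_class \<Delta> r X Y y\<^sub>0 y\<^sub>1 \<rho>\<^sub>o R t m x d by (rule hc)
  show "\<exists>H\<^sub>o. hypothesis_class X Y H\<^sub>o \<and>
      (\<forall>\<eta>\<in>{0<..<1/4}. \<forall>\<epsilon>. 0 < \<epsilon> \<and> \<epsilon> \<le> 1/200 \<longrightarrow>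
         within_factors (1/2000) (9 / \<eta>)
           (sample_complexity (data_space X Y) (robust_loss 0 r) H\<^sub>o \<eta> \<epsilon>)
           (log 2 (1 / \<rho>\<^sub>o) / \<epsilon>\<^sup>2) \<and>
         (\<forall>\<rho>. \<rho>\<^sub>o \<le> \<rho> \<and> \<rho> \<le> 1 - \<rho>\<^sub>o \<longrightarrow>
            within_factors (1/2000) (9 / \<eta>)
              (sample_complexity (data_space X Y) (robust_loss \<rho> r) H\<^sub>o \<eta> \<epsilon>) (1 / \<epsilon>\<^sup>2)) \<and>
         within_factors (1/2000) (9 / \<eta>)
           (sample_complexity (data_space X Y) nominal_loss H\<^sub>o \<eta> \<epsilon>) (1 / \<epsilon>\<^sup>2))"
    unfolding l_def[symmetric]
    using zero_level_complexity[OF l ml(2,3)] high_level_complexity nominal_complexity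
    by (intro exI[of _ cls] conjI cls_hypothesis_class ballI allI impI) simp_all
qed auto

end
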